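(* Let $n\ge 2$, let $q$ be a positive integer, let $p_1,\dots,p_n$ be integers each prime to $q$, and let $$T=\Big\{(a_1,\dots,a_n)\in\mathbb{Z}^n \;\Big|\; \sum_{j=1}^n a_jp_j\equiv 0 \pmod q\Big\}.$$ Let $A$ be a generating matrix of $T$, and let $U$ be a Borel subset of the sphere $S^{n-1}$. Then the value of the harmonic counting measure $\nu_T(U)$ is equal to $$\lim_{t\to\infty}\frac{F_{T\cap C(U)}(t)}{t^{2n-1}}=\frac{\mathrm{B}(n-1,n+1)}{(n-2)!\,2^{n-1}}\,\mathrm{Vol}\big(A^{-1}(C(U))\cap B_{l_1}(0,1)\big).$$
   Context: A generating matrix of $T$ is a matrix $A$ whose columns form a $\mathbb{Z}$-basis of $T$. For $U\subseteq\mathbb{R}^n$, the cone constructed from $U$ is $C(U)=\{tx \mid t\in\mathbb{R}^+,\ x\in U\}$. $B_{l_1}(0,1)$ is the $l_1$-ball of radius $1$ centred at the origin in $\mathbb{R}^n$, and $\mathrm{Vol}$ is the volume in $\mathbb{R}^n$. The beta function is $\mathrm{B}(z,t)=\int_0^1x^{z-1}(1-x)^{t-1}\,dx$. For a cone $K$ with apex at the origin, $N_{T\cap K}(s)$ denotes the number of elements of $T\cap K$ with $l_1$-norm equal to $s$. For a cone $K\subset(\mathbb{R}^+)^n$ set $$F_{T\cap K}(t)=\sum_{s=0}^t\sum_{r=0}^{\lfloor s/2\rfloor}\binom{r+n-2}{n-2}N_{T\cap K}(s-2r).$$ The harmonic counting measure $\nu_T$ associated with $T$ is the measure on the Borel $\sigma$-algebra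 of $S^{n-1}$ defined by $$\nu_T(U):=\lim_{t\to\infty}\frac{F_{T\cap C(U)}(t)}{t^{2n-1}}$$ for $U$ with $C(U)\subset(\mathbb{R}^+)^n$, and extended symmetrically to the other Borel subsets of $S^{n-1}$.
   Formalization: The volume is taken of A^{-1}(C(U)∩B) instead of A^{-1}(C(U))∩B, which depends on the choice of A; the limit equality, and the definition of ν_T by limits, are restricted to Borel U whose cone C(U) has boundary of volume zero, while the value of ν_T(U) is given for all Borel U. *)

theory Defs
  imports "HOL-Analysis.Analysis" "HOL-Number_Theory.Cong"
begin

text \<open>
  \<open>\<int>^n\<close> is embedded in \<open>real ^ 'n\<close>, with \<open>n = CARD('n)\<close>.
\<close>

definition int_vec :: "int ^ 'n \<Rightarrow> real ^ 'n" where
  "int_vec a = (\<chi> j. real_of_int (a $ j))"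

definition congruence_lattice :: "int \<Rightarrow> int ^ 'n \<Rightarrow> (real ^ 'n) set" where
  "congruence_lattice q p = int_vec ` {a. [(\<Sum>j\<in>UNIV. a $ j * p $ j) = 0] (mod q)}"

text \<open>
  Every element of \<open>T\<close> is an integer combination of the columns of \<open>A\<close> in exactly one way,
  and every such combination lies in \<open>T\<close>.
\<close>

definition generating_matrix :: "real ^ 'n ^ 'n \<Rightarrow> (real ^ 'n) set \<Rightarrow> bool" where
  "generating_matrix A T \<longleftrightarrow>
     bij_betw (\<lambda>z :: int ^ 'n. \<Sum>j\<in>UNIV. real_of_int (z $ j) *\<^sub>R column j A) UNIV T"

definition cone_over :: "(real ^ 'n) set \<Rightarrow> (real ^ 'n) set" where
  "cone_over U = {t *\<^sub>R x | t x. t \<ge> 0 \<and> x \<in> U}"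

definition l1_norm :: "real ^ 'n \<Rightarrow> real" where
  "l1_norm x = (\<Sum>i\<in>UNIV. \<bar>x $ i\<bar>)"

text \<open>
  Let \<open>A\<close> be a generating matrix of \<open>T\<close>. As \<open>A\<close> maps \<open>\<int>^n\<close> onto \<open>T\<close>, the points of \<open>T \<inter> K\<close> of
  \<open>l1_norm\<close> at most \<open>t\<close> are counted asymptotically by \<open>t ^ n\<close> times the volume of the inverse
  image under \<open>A\<close> of \<open>K \<inter> l1_unit_ball\<close>. The ball has to be pulled back together with the
  cone: the volume of the intersection of the pulled-back cone with \<open>l1_unit_ball\<close> itself
  depends on the choice of the basis.
\<close>

definition l1_unit_ball :: "(real ^ 'n) set" where
  "l1_unit_ball = {x. l1_norm x \<le> 1}"

text \<open>
  In the next two definitions the argument \<open>L\<close> stands for \<open>T \<inter> K\<close>, the part of the lattice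
  \<open>T\<close> in the cone \<open>K\<close>; it is finite in each \<open>l1_norm\<close>-sphere because \<open>T\<close> consists of integer
  vectors.
\<close>

definition norm_count :: "(real ^ 'n) set \<Rightarrow> nat \<Rightarrow> nat" where
  "norm_count L s = card {x \<in> L. l1_norm x = real s}"

definition harmonic_count :: "(real ^ 'n) set \<Rightarrow> nat \<Rightarrow> nat" where
  "harmonic_count L t =
     (\<Sum>s = 0..t. \<Sum>r = 0..s div 2.
        ((r + CARD('n) - 2) choose (CARD('n) - 2)) * norm_count L (s - 2 * r))"

definition nonneg_orthant :: "(real ^ 'n) set" where
  "nonneg_orthant = {x. \<forall>i. 0 \<le> x $ i}"

text \<open>
  The limit of \<open>harmonic_count (T \<inter> cone_over U) t / t ^ (2n - 1)\<close> is not countably additive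
  in \<open>U\<close>: it vanishes when \<open>U\<close> is one point, but when \<open>U\<close> is the countable set of all
  directions of nonzero vectors of \<open>T\<close> in the orthant it is the limit of the entire orthant.
  So no Borel measure takes these values on all Borel sets. The harmonic counting measure is the
  Borel measure which takes them on the sets \<open>U\<close> in the nonnegative orthant whose cone has a
  frontier of volume zero, and which is invariant under all changes of signs of the coordinates
  (the symmetric extension to the other orthants).
\<close>

definition is_harmonic_counting_measure ::
    "(real ^ 'n) set \<Rightarrow> (real ^ 'n) measure \<Rightarrow> bool" where
  "is_harmonic_counting_measure T \<nu> \<longleftrightarrow>
     sets \<nu> = sets (restrict_space borel (sphere 0 1)) \<and>
     (\<forall>U \<in> sets \<nu>. cone_over U \<subseteq> nonneg_orthant \<and> negligible (frontier (cone_over U)) \<longrightarrow>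
        (\<lambda>t. ennreal (real (harmonic_count (T \<inter> cone_over U) t) / real t ^ (2 * CARD('n) - 1)))
          \<longlonglongrightarrow> emeasure \<nu> U) \<and>
     (\<forall>\<sigma> :: real ^ 'n. (\<forall>i. \<sigma> $ i \<in> {1, - 1}) \<longrightarrow>
        (\<forall>U \<in> sets \<nu>. emeasure \<nu> ((\<lambda>x. \<chi> i. \<sigma> $ i * x $ i) ` U) = emeasure \<nu> U))"

definition harmonic_counting_measure :: "(real ^ 'n) set \<Rightarrow> (real ^ 'n) measure" where
  "harmonic_counting_measure T = (THE \<nu>. is_harmonic_counting_measure T \<nu>)"

end

theory Submission
  imports Defs
begin

text \<open>
  Exchanging the sums turns \<open>harmonic_count\<close> into
  \<open>\<Sum>r \<le> t/2. binomial (r + n - 2) (n - 2) * M (t - 2 r)\<close>, where \<open>M m\<close> is the number of points of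
  \<open>T \<inter> K\<close> of \<open>l1_norm\<close> at most \<open>m\<close>. Since \<open>A\<close> maps \<open>\<int>^n\<close> onto \<open>T\<close>, \<open>M m / m ^ n\<close> tends to the
  volume of the pulled-back set, and the sum is then a Riemann sum of
  \<open>x ^ (n - 2) * (1 - 2 x) ^ n / (n - 2)!\<close> over \<open>[0, 1/2]\<close>, a beta integral. Both limits
  follow from dominated convergence, applied to step functions obtained by rounding down to a grid.

  By uniqueness of Haar measure, pulling back along \<open>A\<close> multiplies volumes by a constant, so the
  limit is a constant times the volume of \<open>cone_over U \<inter> l1_unit_ball\<close>. This is a Borel
  measure in \<open>U\<close> invariant under sign changes. It is the only harmonic counting measure,
  because the caps of the orthant cut out by upper bounds on the normalised coordinates
  \<open>x / l1_norm x\<close> have convex cones, are stable under intersection, and generate the Borel sets.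
\<close>

subsection \<open>Volumes under linear bijections\<close>

lemma nn_integral_lborel_translate:
  fixes h :: "'a::euclidean_space \<Rightarrow> ennreal"
  assumes "h \<in> borel_measurable borel"
  shows "(\<integral>\<^sup>+x. h (x + a) \<partial>lborel) = (\<integral>\<^sup>+x. h x \<partial>lborel)"
proof -
  have "(\<integral>\<^sup>+x. h x \<partial>lborel) = (\<integral>\<^sup>+x. h x \<partial>(distr lborel borel ((+) a)))"
    by (simp add: lborel_distr_plus)
  also have "\<dots> = (\<integral>\<^sup>+x. h (a + x) \<partial>lborel)"
    using assms by (intro nn_integral_distr) auto
  finally show ?thesis by (simp add: add.commute)
qed

text \<open>
  The library's \<open>measure_linear_image\<close> needs a wellordered index type, so the scaling of volumes is
  obtained here from the Fubini proof of the uniqueness of Haar measure.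
\<close>

lemma emeasure_linear_vimage:
  fixes f :: "'a::euclidean_space \<Rightarrow> 'a"
  assumes f: "linear f" "bij f"
  obtains c where "c \<ge> 0"
    "\<And>S. S \<in> sets borel \<Longrightarrow> emeasure lborel (f -` S) = ennreal c * emeasure lborel S"
proof -
  define \<mu> where "\<mu> = distr lborel borel f"
  have inv_lin: "linear (inv f)"
  proof -
    obtain g where g: "linear g" "g \<circ> f = id"
      using linear_injective_left_inverse[OF f(1) bij_is_inj[OF f(2)]] by blast
    have "inv f = g"
      using g(2) f(2) by (metis bij_is_surj inv_unique_comp o_inv_distrib surj_iff comp_assoc comp_id id_comp)
    with g show ?thesis by simp
  qed
  have [measurable]: "f \<in> borel_measurable borel" "inv f \<in> borel_measurable borel"
    using f inv_lin by (auto intro!: borel_measurable_continuous_onI linear_continuous_on simp: linear_conv_bounded_linear)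
  have sets_\<mu>[measurable_cong]: "sets \<mu> = sets borel" by (simp add: \<mu>_def)
  \<comment> \<open>Fubini needs \<open>\<mu>\<close> to be sigma-finite. Pushing
    \<open>\<mu>\<close> back along \<open>inv f\<close> gives \<open>lborel\<close>, and
    sigma-finiteness of an image measure passes to its source.\<close>
  have "distr \<mu> borel (inv f) = lborel"
    using f(2) unfolding \<mu>_def
    by (subst distr_distr) (auto simp: o_def bij_is_inj distr_id2)
  then have "sigma_finite_measure (distr \<mu> borel (inv f))"
    by (simp add: lborel.sigma_finite_measure_axioms)
  then have "sigma_finite_measure \<mu>"
    by (rule sigma_finite_measure_distr) simp
  then interpret \<mu>: sigma_finite_measure \<mu> .
  interpret P: pair_sigma_finite \<mu> lborel ..
  \<comment> \<open>Translating \<open>\<mu>\<close> by \<open>a\<close> amounts to translating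
    \<open>lborel\<close> by \<open>inv f a\<close>, so \<open>\<mu>\<close> is translation
    invariant too.\<close>
  have shift: "(\<integral>\<^sup>+x. h (x + a) \<partial>\<mu>) = (\<integral>\<^sup>+x. h x \<partial>\<mu>)"
    if [measurable]: "h \<in> borel_measurable borel" for h :: "'a \<Rightarrow> ennreal" and a
  proof -
    have a: "a = f (inv f a)" using f(2) by (simp add: bij_is_surj surj_f_inv_f)
    have "(\<integral>\<^sup>+x. h (x + a) \<partial>\<mu>) = (\<integral>\<^sup>+x. h (f x + a) \<partial>lborel)"
      unfolding \<mu>_def by (subst nn_integral_distr) auto
    also have "\<dots> = (\<integral>\<^sup>+x. h (f (x + inv f a)) \<partial>lborel)"
      using a linear_add[OF f(1)] by metis
    also have "\<dots> = (\<integral>\<^sup>+x. h (f x) \<partial>lborel)"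
      by (rule nn_integral_lborel_translate) simp
    also have "\<dots> = (\<integral>\<^sup>+x. h x \<partial>\<mu>)"
      unfolding \<mu>_def by (subst nn_integral_distr) auto
    finally show ?thesis .
  qed
  define Q :: "'a set" where "Q = cbox 0 One"
  have [measurable]: "Q \<in> sets borel" by (simp add: Q_def)
  have Q1: "emeasure lborel Q = 1"
    by (simp add: Q_def emeasure_lborel_cbox_eq)
  \<comment> \<open>\<open>c\<close> is the \<open>\<mu>\<close>-mass of the reflected unit cube. It
    appears when the double integral of \<open>indicator S x * indicator Q (y - x)\<close> is
    computed in the other order: for fixed \<open>y\<close> invariance of \<open>\<mu>\<close>
    replaces \<open>x\<close> by \<open>x + y\<close>, and then invariance of \<open>lborel\<close>
    in \<open>y\<close> splits off the volume of \<open>S\<close>.\<close>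
  define c where "c = (\<integral>\<^sup>+x. indicator Q (- x) \<partial>\<mu>)"
  have key: "emeasure \<mu> S = c * emeasure lborel S" if [measurable]: "S \<in> sets borel" for S
  proof -
    have "emeasure \<mu> S = (\<integral>\<^sup>+x. indicator S x * emeasure lborel Q \<partial>\<mu>)"
      by (simp add: Q1 sets_\<mu>)
    also have "\<dots> = (\<integral>\<^sup>+x. \<integral>\<^sup>+y. indicator S x * indicator Q (y - x) \<partial>lborel \<partial>\<mu>)"
    proof (rule nn_integral_cong)
      fix x
      have "emeasure lborel Q = (\<integral>\<^sup>+y. indicator Q (y - x) \<partial>lborel)"
        using nn_integral_lborel_translate[of "indicator Q" "- x"] by simp
      then show "indicator S x * emeasure lborel Q = (\<integral>\<^sup>+y. indicator S x * indicator Q (y - x) \<partial>lborel)"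
        by (simp add: nn_integral_cmult)
    qed
    also have "\<dots> = (\<integral>\<^sup>+y. \<integral>\<^sup>+x. indicator S x * indicator Q (y - x) \<partial>\<mu> \<partial>lborel)"
      by (rule P.Fubini'[symmetric]) measurable
    also have "\<dots> = (\<integral>\<^sup>+y. \<integral>\<^sup>+x. indicator S (x + y) * indicator Q (- x) \<partial>\<mu> \<partial>lborel)"
    proof (rule nn_integral_cong)
      fix y
      show "(\<integral>\<^sup>+x. indicator S x * indicator Q (y - x) \<partial>\<mu>) = (\<integral>\<^sup>+x. indicator S (x + y) * indicator Q (- x) \<partial>\<mu>)"
        using shift[of "\<lambda>x. indicator S x * indicator Q (y - x)" y] by simp
    qed
    also have "\<dots> = (\<integral>\<^sup>+x. \<integral>\<^sup>+y. indicator S (x + y) * indicator Q (- x) \<partial>lborel \<partial>\<mu>)"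
      by (rule P.Fubini') measurable
    also have "\<dots> = (\<integral>\<^sup>+x. emeasure lborel S * indicator Q (- x) \<partial>\<mu>)"
    proof (rule nn_integral_cong)
      fix x
      show "(\<integral>\<^sup>+y. indicator S (x + y) * indicator Q (- x) \<partial>lborel) = emeasure lborel S * indicator Q (- x)"
        using nn_integral_lborel_translate[of "indicator S" x]
        by (simp add: nn_integral_multc add.commute)
    qed
    also have "\<dots> = c * emeasure lborel S"
      unfolding c_def by (subst nn_integral_cmult) (auto simp: mult.commute)
    finally show ?thesis .
  qed
  have \<mu>_eq: "emeasure \<mu> S = emeasure lborel (f -` S)" if "S \<in> sets borel" for S
    using that by (simp add: \<mu>_def emeasure_distr)
  \<comment> \<open>The factor is finite: on \<open>Q\<close>, of volume 1, it equals the volume of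
    a linear image of the cube, which is bounded.\<close>
  have "f -` Q = inv f ` Q" using f(2) by (simp add: bij_vimage_eq_inv_image)
  moreover have "bounded (inv f ` Q)"
    using inv_lin by (intro bounded_linear_image) (auto simp: Q_def linear_conv_bounded_linear)
  ultimately have "emeasure lborel (f -` Q) < \<infinity>"
    using emeasure_bounded_finite[of "inv f ` Q"] by simp
  then have "c < \<infinity>"
    using key[of Q] \<mu>_eq[of Q] Q1 by simp
  then obtain c' where "c' \<ge> 0" "c = ennreal c'"
    by (cases c) auto
  then show ?thesis
    using key \<mu>_eq that by metis
qed

subsection \<open>Cones and the \<open>l1\<close>-ball\<close>

text \<open>The ray from the origin through a nonzero \<open>x\<close> meets the unit sphere only in
  \<open>sgn x\<close>. Away from the apex the cone is thus a preimage under the measurable map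
  \<open>sgn\<close>.\<close>

lemma cone_over_iff:
  assumes "U \<subseteq> sphere 0 1" "x \<noteq> 0"
  shows "x \<in> cone_over U \<longleftrightarrow> sgn x \<in> U"
proof
  assume "x \<in> cone_over U"
  then obtain t u where tu: "x = t *\<^sub>R u" "t \<ge> 0" "u \<in> U"
    by (auto simp: cone_over_def)
  then have "norm u = 1" "t > 0" using assms by (auto simp: less_le)
  then show "sgn x \<in> U" using tu by (simp add: sgn_div_norm)
next
  assume "sgn x \<in> U"
  moreover have "x = norm x *\<^sub>R sgn x" using assms by (simp add: sgn_div_norm)
  moreover have "norm x \<ge> 0" by simp
  ultimately show "x \<in> cone_over U" unfolding cone_over_def mem_Collect_eq by blast
qed

lemma zero_mem_cone_over: "0 \<in> cone_over U \<longleftrightarrow> U \<noteq> {}"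
  by (force simp: cone_over_def)

lemma scaleR_mem_cone_over:
  fixes x :: "real ^ 'n"
  assumes "c > 0"
  shows "c *\<^sub>R x \<in> cone_over U \<longleftrightarrow> x \<in> cone_over U"
proof -
  have *: "c *\<^sub>R x \<in> cone_over U" if c: "c > 0" and x: "x \<in> cone_over U" for c and x :: "real ^ 'n"
  proof -
    obtain t u where "x = t *\<^sub>R u" "t \<ge> 0" "u \<in> U"
      using x by (auto simp: cone_over_def)
    then have "c *\<^sub>R x = (c * t) *\<^sub>R u" "c * t \<ge> 0"
      using c by auto
    then show ?thesis using \<open>u \<in> U\<close> unfolding cone_over_def by blast
  qed
  show ?thesis
    using *[of c x] *[of "inverse c" "c *\<^sub>R x"] assms by auto
qed

lemma cone_over_borel:
  fixes U :: "(real ^ 'n) set"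
  assumes "U \<subseteq> sphere 0 1" "U \<in> sets borel"
  shows "cone_over U \<in> sets borel"
proof -
  have "sgn -` U \<in> sets borel"
    using measurable_sets[OF borel_measurable_sgn assms(2)] by simp
  then have "(sgn -` U - {0}) \<union> (if U = {} then {} else {0}) \<in> sets borel"
    by auto
  also have "(sgn -` U - {0}) \<union> (if U = {} then {} else {0}) = cone_over U"
    using cone_over_iff[OF assms(1)] zero_mem_cone_over[of U] by (auto split: if_splits) metis+
  finally show ?thesis .
qed

lemma l1_norm_scaleR: "l1_norm (c *\<^sub>R x) = \<bar>c\<bar> * l1_norm x"
  by (simp add: l1_norm_def abs_mult sum_distrib_left)

lemma norm_le_l1_norm: "norm x \<le> l1_norm x"
  unfolding l1_norm_def by (rule norm_le_l1_cart)

lemma l1_norm_pos: "x \<noteq> 0 \<Longrightarrow> l1_norm x > 0"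
  using norm_le_l1_norm[of x] by (metis order_less_le_trans zero_less_norm_iff)

lemma l1_norm_measurable [measurable]: "l1_norm \<in> borel_measurable borel"
  unfolding l1_norm_def
  by (intro borel_measurable_continuous_onI continuous_intros)

lemma bounded_l1_unit_ball: "bounded l1_unit_ball"
  using norm_le_l1_norm by (auto simp: bounded_iff l1_unit_ball_def intro: order_trans)

lemma l1_unit_ball_borel: "l1_unit_ball \<in> sets borel"
  unfolding l1_unit_ball_def by measurable

lemma negligible_frontier_l1_unit_ball: "negligible (frontier l1_unit_ball)"
proof (rule negligible_convex_frontier, rule convexI)
  fix x y :: "real ^ 'n" and u v :: real
  assume xy: "x \<in> l1_unit_ball" "y \<in> l1_unit_ball" and uv: "0 \<le> u" "0 \<le> v" "u + v = 1"
  have "l1_norm (u *\<^sub>R x + v *\<^sub>R y) \<le> l1_norm (u *\<^sub>R x) + l1_norm (v *\<^sub>R y)"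
    unfolding l1_norm_def sum.distrib[symmetric]
    by (intro sum_mono) (auto simp: abs_triangle_ineq)
  also have "\<dots> \<le> u * 1 + v * 1"
    unfolding l1_norm_scaleR
    using xy uv by (intro add_mono mult_mono) (auto simp: l1_unit_ball_def l1_norm_def sum_nonneg)
  finally show "u *\<^sub>R x + v *\<^sub>R y \<in> l1_unit_ball"
    using uv by (simp add: l1_unit_ball_def)
qed

subsection \<open>Lattice points in dilated Jordan sets\<close>

lemma finite_int_vec_bounded:
  fixes S :: "(real ^ 'n) set"
  assumes "bounded S"
  shows "finite {z :: int ^ 'n. int_vec z \<in> S}"
proof -
  obtain B where B: "\<And>x. x \<in> S \<Longrightarrow> norm x \<le> B"
    using assms by (auto simp: bounded_iff)
  have "{z :: int ^ 'n. int_vec z \<in> S} \<subseteq> vec_lambda ` (UNIV \<rightarrow>\<^sub>E {- \<lceil>B\<rceil>..\<lceil>B\<rceil>})"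
  proof
    fix z :: "int ^ 'n"
    assume "z \<in> {z. int_vec z \<in> S}"
    then have *: "norm (int_vec z) \<le> B"
      using B by auto
    have "- \<lceil>B\<rceil> \<le> z $ i \<and> z $ i \<le> \<lceil>B\<rceil>" for i
    proof -
      have "\<bar>real_of_int (z $ i)\<bar> \<le> B"
        using component_le_norm_cart[of "int_vec z" i] * by (simp add: int_vec_def)
      then show ?thesis by linarith
    qed
    then have "vec_nth z \<in> UNIV \<rightarrow>\<^sub>E {- \<lceil>B\<rceil>..\<lceil>B\<rceil>}"
      by (auto simp: PiE_def)
    then show "z \<in> vec_lambda ` (UNIV \<rightarrow>\<^sub>E {- \<lceil>B\<rceil>..\<lceil>B\<rceil>})"
      by (metis image_eqI vec_nth_inverse)
  qed
  moreover have "finite (vec_lambda ` ((UNIV :: 'n set) \<rightarrow>\<^sub>E {- \<lceil>B\<rceil>..\<lceil>B\<rceil>}))"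
    by (intro finite_imageI finite_PiE) auto
  ultimately show ?thesis
    by (rule finite_subset)
qed

text \<open>Names the half-open grid cube of side \<open>1 / t\<close> around \<open>x\<close> by
  its lowest corner, multiplied by \<open>t\<close>. Rounding to that corner turns counts of grid
  points into integrals.\<close>

definition grid_floor :: "nat \<Rightarrow> real ^ 'n \<Rightarrow> int ^ 'n" where
  "grid_floor t x = (\<chi> i. \<lfloor>real t * x $ i\<rfloor>)"

lemma norm_grid_floor_diff:
  assumes "t > 0"
  shows "norm (int_vec (grid_floor t x) /\<^sub>R real t - (x :: real ^ 'n)) \<le> real CARD('n) / real t"
proof -
  have "\<bar>(int_vec (grid_floor t x) /\<^sub>R real t - x) $ i\<bar> \<le> 1 / real t" for i
  proof -
    have "(int_vec (grid_floor t x) /\<^sub>R real t - x) $ i =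
        (of_int \<lfloor>real t * x $ i\<rfloor> - real t * x $ i) / real t"
      using assms by (simp add: int_vec_def grid_floor_def field_simps)
    moreover have "\<bar>of_int \<lfloor>real t * x $ i\<rfloor> - real t * x $ i\<bar> \<le> 1"
      by linarith
    ultimately show ?thesis
      by (simp add: divide_right_mono)
  qed
  then have "(\<Sum>i\<in>UNIV. \<bar>(int_vec (grid_floor t x) /\<^sub>R real t - x) $ i\<bar>) \<le> (\<Sum>i\<in>(UNIV::'n set). 1 / real t)"
    by (intro sum_mono) auto
  then show ?thesis
    using norm_le_l1_cart[of "int_vec (grid_floor t x) /\<^sub>R real t - x"] by simp
qed

lemma grid_floor_measurable:
  "(\<lambda>x :: real ^ 'n. int_vec (grid_floor t x) /\<^sub>R real t) \<in> borel_measurable borel"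
  by (subst borel_measurable_euclidean_space)
     (auto simp: int_vec_def grid_floor_def Basis_vec_def inner_axis)

text \<open>The fibre is a half-open cube of side \<open>1 / t\<close>, squeezed between the open
  and the closed cube, which have equal volume.\<close>

lemma grid_floor_cube:
  fixes z :: "int ^ 'n"
  assumes "t > 0"
  shows "grid_floor t -` {z} \<in> sets lborel" 
    and "emeasure lborel (grid_floor t -` {z}) = ennreal (1 / real t ^ CARD('n))"
proof -
  define a where "a = (\<chi> i. real_of_int (z $ i) / real t)"
  define b where "b = (\<chi> i. (real_of_int (z $ i) + 1) / real t)"
  have eq: "grid_floor t -` {z} = {x. \<forall>i. a $ i \<le> x $ i \<and> x $ i < b $ i}"
    using assms unfolding grid_floor_def a_def b_def
    by (simp add: vec_eq_iff floor_eq_iff pos_divide_le_eq pos_less_divide_eq mult.commute vimage_def)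
  show meas: "grid_floor t -` {z} \<in> sets lborel"
    unfolding eq by measurable
  have ab: "box a b \<subseteq> grid_floor t -` {z}" "grid_floor t -` {z} \<subseteq> cbox a b"
    unfolding eq by (auto simp: mem_box_cart less_imp_le)
  have le: "a $ i \<le> b $ i" for i
    using assms by (simp add: a_def b_def divide_right_mono)
  then have leB: "\<forall>i\<in>Basis. a \<bullet> i \<le> b \<bullet> i"
    by (auto simp: Basis_vec_def inner_axis)
  have "cbox a b \<noteq> {}"
    using leB by (simp add: box_ne_empty)
  then have "measure lborel (cbox a b) = (\<Prod>i\<in>UNIV. b $ i - a $ i)"
    by (rule content_cbox_cart)
  also have "\<dots> = (\<Prod>i\<in>(UNIV::'n set). 1 / real t)"
    by (intro prod.cong) (auto simp: a_def b_def diff_divide_distrib[symmetric])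
  finally have m: "measure lborel (cbox a b) = 1 / real t ^ CARD('n)"
    by (simp add: power_one_over)
  have c: "emeasure lborel (cbox a b) = ennreal (1 / real t ^ CARD('n))"
    using emeasure_lborel_cbox_finite[of a b] by (simp add: emeasure_eq_ennreal_measure m)
  have "emeasure lborel (box a b) = emeasure lborel (cbox a b)"
    using leB by (simp add: emeasure_lborel_cbox_eq emeasure_lborel_box_eq)
  moreover have "emeasure lborel (box a b) \<le> emeasure lborel (grid_floor t -` {z})"
     "emeasure lborel (grid_floor t -` {z}) \<le> emeasure lborel (cbox a b)"
    using ab meas by (auto intro!: emeasure_mono)
  ultimately show "emeasure lborel (grid_floor t -` {z}) = ennreal (1 / real t ^ CARD('n))"
    using c by auto
qed

text \<open>The integrand is constant on each grid cube. It is 1 on the finitely many cubes whose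
  lowest corner lies in \<open>D\<close>, each of volume \<open>1 / t ^ n\<close>.\<close>

lemma integral_grid_indicator:
  fixes D :: "(real ^ 'n) set"
  assumes "bounded D" "t > 0"
  shows "(\<integral>x. indicator D (int_vec (grid_floor t x) /\<^sub>R real t) \<partial>lborel) =
    real (card {z :: int ^ 'n. int_vec z /\<^sub>R real t \<in> D}) / real t ^ CARD('n)"
proof -
  let ?Z = "{z :: int ^ 'n. int_vec z /\<^sub>R real t \<in> D}"
  have "?Z = {z. int_vec z \<in> (\<lambda>x. real t *\<^sub>R x) ` D}"
    using assms(2) by (auto intro!: rev_image_eqI)
  then have fin: "finite ?Z"
    using finite_int_vec_bounded[OF bounded_scaling[OF assms(1)]] by metis
  have "indicator D (int_vec (grid_floor t x) /\<^sub>R real t) =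
      (\<Sum>z\<in>?Z. indicator (grid_floor t -` {z}) x :: real)" for x
  proof -
    have "(\<Sum>z\<in>?Z. indicator (grid_floor t -` {z}) x :: real) =
        (\<Sum>z\<in>?Z. if z = grid_floor t x then 1 else 0)"
      by (intro sum.cong) (auto simp: indicator_def)
    then show ?thesis
      using fin by (simp add: sum.delta' indicator_def)
  qed
  then have "(\<integral>x. indicator D (int_vec (grid_floor t x) /\<^sub>R real t) \<partial>lborel) =
      (\<integral>x. (\<Sum>z\<in>?Z. indicator (grid_floor t -` {z}) x :: real) \<partial>lborel)"
    by simp
  also have "\<dots> = (\<Sum>z\<in>?Z. \<integral>x. indicator (grid_floor t -` {z}) x \<partial>lborel)"
    using grid_floor_cube(1)[OF assms(2)]
    by (intro Bochner_Integration.integral_sum integrable_real_indicator)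
       (simp_all add: grid_floor_cube(2)[OF assms(2)])
  also have "\<dots> = (\<Sum>z\<in>?Z. 1 / real t ^ CARD('n))"
    using grid_floor_cube(1)[OF assms(2)]
    by (intro sum.cong) (simp_all add: measure_def grid_floor_cube(2)[OF assms(2)])
  finally show ?thesis by simp
qed

text \<open>Off the frontier a point is interior to \<open>D\<close> or to its complement, and both
  interiors are open.\<close>

lemma eventually_mem_iff_not_frontier:
  assumes "x \<notin> frontier D" "(f \<longlongrightarrow> x) F"
  shows "eventually (\<lambda>t. f t \<in> D \<longleftrightarrow> x \<in> D) F"
proof (cases "x \<in> D")
  case True
  then have "x \<in> interior D"
    using assms(1) by (auto simp: frontier_def closure_def)
  then have "eventually (\<lambda>t. f t \<in> interior D) F"
    using assms(2) by (auto dest: topological_tendstoD)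
  then show ?thesis
    using True interior_subset by (auto elim!: eventually_mono)
next
  case False
  then have "x \<in> - closure D"
    using assms(1) interior_subset by (auto simp: frontier_def)
  then have "eventually (\<lambda>t. f t \<in> - closure D) F"
    using assms(2) by (metis topological_tendstoD open_Compl closed_closure)
  then show ?thesis
    using False closure_subset by (auto elim!: eventually_mono)
qed

text \<open>The corner of the grid cube around \<open>x\<close> tends to \<open>x\<close>, so the
  indicator of \<open>D\<close> at the corner converges to that at \<open>x\<close> off the
  frontier, hence almost everywhere. Dominated convergence carries this over to the
  integrals.\<close>

lemma lattice_point_asymptotics:
  fixes D :: "(real ^ 'n) set"
  assumes "bounded D" "D \<in> sets borel" "negligible (frontier D)"
  shows "(\<lambda>t. real (card {z :: int ^ 'n. int_vec z /\<^sub>R real t \<in> D}) / real t ^ CARD('n))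
    \<longlonglongrightarrow> measure lebesgue D"
proof -
  let ?f = "\<lambda>t x. indicator D (int_vec (grid_floor t x) /\<^sub>R real t) :: real"
  obtain B where B: "\<And>x. x \<in> D \<Longrightarrow> norm x \<le> B"
    using assms by (auto simp: bounded_iff)
  \<comment> \<open>The shift to \<open>Suc t\<close> avoids \<open>t = 0\<close>, where every point
    is rounded to the origin. For \<open>Suc t\<close> rounding moves a point by at most
    \<open>CARD('n)\<close>, so a ball enlarged by that radius dominates.\<close>
  have "(\<lambda>t. \<integral>x. ?f (Suc t) x \<partial>lborel) \<longlonglongrightarrow> (\<integral>x. indicator D x \<partial>lborel)"
  proof (rule integral_dominated_convergence)
    show "indicator D \<in> borel_measurable lborel"
      using assms by simp
    show "?f (Suc t) \<in> borel_measurable lborel" for t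
      using measurable_compose[OF grid_floor_measurable borel_measurable_indicator[OF assms(2)],
          of "Suc t"]
      by (simp del: of_nat_Suc)
    show "integrable lborel (indicator (cball 0 (B + real CARD('n))) :: real ^ 'n \<Rightarrow> real)"
      by (intro integrable_real_indicator) (use emeasure_bounded_finite[of "cball (0 :: real ^ 'n) (B + real CARD('n))"] in simp_all)
    show "AE x in lborel. norm (?f (Suc t) x) \<le> indicator (cball 0 (B + real CARD('n))) x" for t
    proof (rule AE_I2)
      fix x :: "real ^ 'n"
      let ?y = "int_vec (grid_floor (Suc t) x) /\<^sub>R real (Suc t)"
      have "norm x \<le> norm ?y + norm (?y - x)"
        by (metis norm_minus_commute norm_triangle_sub)
      also have "norm (?y - x) \<le> real CARD('n) / real (Suc t)"
        by (rule norm_grid_floor_diff) simp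
      also have "\<dots> \<le> real CARD('n)"
        by (simp add: field_simps)
      finally show "norm (?f (Suc t) x) \<le> indicator (cball 0 (B + real CARD('n))) x"
        using B[of ?y] by (auto simp: indicator_def)
    qed
    have "AE x in lborel. x \<notin> frontier D"
      using assms(3) by (intro AE_not_in)
        (auto simp: negligible_iff_null_sets null_sets_def)
    then show "AE x in lborel. (\<lambda>t. ?f (Suc t) x) \<longlonglongrightarrow> indicator D x"
    proof eventually_elim
      case (elim x)
      have "(\<lambda>t. int_vec (grid_floor t x) /\<^sub>R real t - x) \<longlonglongrightarrow> 0"
      proof (rule Lim_null_comparison)
        show "eventually (\<lambda>t. norm (int_vec (grid_floor t x) /\<^sub>R real t - x) \<le> real CARD('n) / real t) sequentially"
          using eventually_gt_at_top[of 0] by eventually_elim (rule norm_grid_floor_diff)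
        show "(\<lambda>t. real CARD('n) / real t) \<longlonglongrightarrow> 0"
          by (rule lim_const_over_n)
      qed
      then have "(\<lambda>t. int_vec (grid_floor t x) /\<^sub>R real t) \<longlonglongrightarrow> x"
        by (simp add: LIM_zero_iff)
      from eventually_mem_iff_not_frontier[OF elim this]
      have "eventually (\<lambda>t. ?f t x = indicator D x) sequentially"
        by eventually_elim (auto simp: indicator_def)
      then have "(\<lambda>t. ?f t x) \<longlonglongrightarrow> indicator D x"
        by (rule tendsto_eventually)
      then show ?case
        by (rule LIMSEQ_Suc)
    qed
  qed
  also have "(\<integral>x. indicator D x \<partial>lborel) = measure lebesgue D"
    using assms(2) by simp
  finally have "(\<lambda>t. \<integral>x. ?f (Suc t) x \<partial>lborel) \<longlonglongrightarrow> measure lebesgue D" .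
  then have "(\<lambda>t. real (card {z :: int ^ 'n. int_vec z /\<^sub>R real (Suc t) \<in> D}) / real (Suc t) ^ CARD('n))
    \<longlonglongrightarrow> measure lebesgue D"
    by (subst (asm) integral_grid_indicator[OF assms(1)]) simp_all
  then show ?thesis
    by (rule LIMSEQ_imp_Suc)
qed

subsection \<open>Weighted sums of counting functions\<close>

text \<open>The binomial coefficient is a product of \<open>k\<close> factors
  \<open>f t + i + 1\<close> over \<open>fact k\<close>, and each factor divided by \<open>t\<close>
  tends to \<open>x\<close>.\<close>

lemma binomial_over_power_tendsto:
  fixes k :: nat and f :: "nat \<Rightarrow> nat"
  assumes "(\<lambda>t. real (f t) / real t) \<longlonglongrightarrow> x"
  shows "(\<lambda>t. real ((f t + k) choose k) / real t ^ k) \<longlonglongrightarrow> x ^ k / fact k"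
proof -
  have "real ((f t + k) choose k) / real t ^ k =
      (\<Prod>i<k. real (f t) / real t + real (Suc i) / real t) / fact k" for t
  proof -
    have "real ((f t + k) choose k) = pochhammer (real (f t) + 1) k / fact k"
      by (simp add: binomial_gbinomial gbinomial_pochhammer')
    also have "pochhammer (real (f t) + 1) k = (\<Prod>i<k. real (f t) + real (Suc i))"
      by (simp add: pochhammer_prod atLeast0LessThan algebra_simps)
    finally show ?thesis
      by (simp add: add_divide_distrib[symmetric] prod_dividef)
  qed
  moreover have "(\<lambda>t. (\<Prod>i<k. real (f t) / real t + real (Suc i) / real t) / fact k)
      \<longlonglongrightarrow> (\<Prod>i<k. x + 0) / fact k"
    by (intro tendsto_intros tendsto_prod tendsto_add assms lim_const_over_n) auto
  ultimately show ?thesis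
    by simp
qed

lemma binomial_over_power_le:
  assumes "r \<le> t" "t > 0"
  shows "real ((r + k) choose k) / real t ^ k \<le> (real k + 1) ^ k"
proof -
  have "real ((r + k) choose k) \<le> real ((r + k) ^ k)"
    using binomial_le_pow[of k "r + k"] by (simp only: of_nat_le_iff)
  also have "\<dots> = (real r + real k) ^ k" by simp
  also have "\<dots> \<le> ((real k + 1) * real t) ^ k"
  proof (rule power_mono)
    have "real k \<le> real k * real t"
      using assms by (cases "k = 0") (auto simp: mult_le_cancel_left1)
    then show "real r + real k \<le> (real k + 1) * real t"
      using assms by (simp add: algebra_simps)
  qed simp
  finally show ?thesis
    using assms by (simp add: power_mult_distrib divide_le_eq)
qed

lemma nat_floor_cell:
  assumes "t > 0"
  shows "{x::real. 0 \<le> x \<and> nat \<lfloor>real t * x\<rfloor> = r} = {real r / real t..<(real r + 1) / real t}"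
proof -
  have "0 \<le> x \<and> nat \<lfloor>real t * x\<rfloor> = r \<longleftrightarrow> real r \<le> real t * x \<and> real t * x < real r + 1" for x
  proof
    assume *: "0 \<le> x \<and> nat \<lfloor>real t * x\<rfloor> = r"
    then have "\<lfloor>real t * x\<rfloor> = int r"
      by (metis nat_eq_iff2 of_nat_0_le_iff zero_le_floor zero_le_mult_iff nat_0_le)
    then show "real r \<le> real t * x \<and> real t * x < real r + 1"
      by (simp add: floor_eq_iff)
  next
    assume *: "real r \<le> real t * x \<and> real t * x < real r + 1"
    then have "\<lfloor>real t * x\<rfloor> = int r"
      by (simp add: floor_eq_iff)
    moreover have "0 \<le> real t * x"
      using * by (meson of_nat_0_le_iff order_trans)
    ultimately show "0 \<le> x \<and> nat \<lfloor>real t * x\<rfloor> = r"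
      using assms by (simp add: zero_le_mult_iff)
  qed
  then show ?thesis
    using assms by (simp add: set_eq_iff pos_divide_le_eq pos_less_divide_eq mult.commute)
qed

text \<open>The integrand is the step function with value \<open>g r\<close> on the cell from
  \<open>r / t\<close> to \<open>(r + 1) / t\<close>, whose length is \<open>1 / t\<close>.\<close>

lemma Riemann_sum_eq_integral:
  fixes g :: "nat \<Rightarrow> real"
  assumes "t > 0"
  shows "(\<Sum>r = 0..m. g r) / real t =
    (\<integral>x. (if 0 \<le> x \<and> nat \<lfloor>real t * x\<rfloor> \<le> m then g (nat \<lfloor>real t * x\<rfloor>) else 0) \<partial>lborel)"
proof -
  let ?I = "\<lambda>r. {real r / real t..<(real r + 1) / real t}"
  have le: "real r / real t \<le> (real r + 1) / real t" for r
    by (intro divide_right_mono) auto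
  have "(if 0 \<le> x \<and> nat \<lfloor>real t * x\<rfloor> \<le> m then g (nat \<lfloor>real t * x\<rfloor>) else 0) =
      (\<Sum>r = 0..m. g r * indicator (?I r) x)" for x
  proof -
    have "(\<Sum>r = 0..m. g r * indicator (?I r) x) =
        (\<Sum>r = 0..m. if r = nat \<lfloor>real t * x\<rfloor> then if 0 \<le> x then g r else 0 else 0)"
      unfolding nat_floor_cell[OF assms, symmetric]
      by (intro sum.cong) (auto simp: indicator_def)
    then show ?thesis
      by (simp add: sum.delta)
  qed
  then have "(\<integral>x. (if 0 \<le> x \<and> nat \<lfloor>real t * x\<rfloor> \<le> m then g (nat \<lfloor>real t * x\<rfloor>) else 0) \<partial>lborel) =
    (\<integral>x. (\<Sum>r = 0..m. g r * indicator (?I r) x) \<partial>lborel)"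
    by simp
  also have "\<dots> = (\<Sum>r = 0..m. \<integral>x. g r * indicator (?I r) x \<partial>lborel)"
    by (intro Bochner_Integration.integral_sum integrable_mult_right integrable_real_indicator)
       (auto simp: le)
  also have "\<dots> = (\<Sum>r = 0..m. g r * (1 / real t))"
    using le by (intro sum.cong) (simp_all add: diff_divide_distrib[symmetric] measure_def)
  finally show ?thesis
    by (simp add: sum_divide_distrib)
qed

text \<open>Substituting \<open>y = 2 * x\<close> in the beta integral gives a factor 2 from the
  differential and \<open>2 ^ (n - 2)\<close> from the power of \<open>y\<close>.\<close>

lemma integral_Beta_half:
  assumes "n \<ge> 2"
  shows "(\<integral>x. (x ^ (n - 2) * (1 - 2 * x) ^ n) * indicator {0..1/2::real} x \<partial>lborel) =
    Beta (real n - 1) (real n + 1) / 2 ^ (n - 1)"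
proof -
  let ?g = "\<lambda>y::real. y ^ (n - 2) * (1 - y) ^ n"
  let ?f = "\<lambda>y. ?g y * indicator {0..1::real} y"
  have int: "set_integrable lborel {0..1} ?g"
    by (intro borel_integrable_atLeastAtMost' continuous_intros)
  have B: "((\<lambda>y. y powr (real n - 1 - 1) * (1 - y) powr (real n + 1 - 1)) has_integral
      Beta (real n - 1) (real n + 1)) {0..1}"
    using assms by (intro has_integral_Beta_real) auto
  \<comment> \<open>The endpoints are left out because real and natural powers can differ at 0:
    \<open>0 powr 0 = 0\<close>, but \<open>0 ^ 0 = 1\<close>. A finite set does not change the
    integral.\<close>
  have E: "y powr (real n - 1 - 1) * (1 - y) powr (real n + 1 - 1) = ?g y" if "y \<in> {0..1} - {0, 1}" for y :: real
  proof -
    have "real n - 1 - 1 = real (n - 2)" "real n + 1 - 1 = real n"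
      using assms by auto
    moreover have "0 < y" "0 < 1 - y"
      using that by auto
    ultimately show ?thesis
      by (metis powr_realpow)
  qed
  have "(?g has_integral Beta (real n - 1) (real n + 1)) {0..1}"
    by (rule has_integral_spike_finite[OF _ _ B, of "{0, 1}"]) (simp, rule E[symmetric])
  then have "Beta (real n - 1) (real n + 1) = (\<integral>x. ?f x \<partial>lborel)"
    using set_borel_integral_eq_integral(2)[OF int]
    by (simp add: set_lebesgue_integral_def integral_unique mult.commute)
  also have "\<dots> = 2 * (\<integral>x. ?f (0 + 2 * x) \<partial>lborel)"
    by (subst lborel_integral_real_affine[where c = 2 and t = 0]) auto
  also have "(\<lambda>x. ?f (0 + 2 * x)) =
      (\<lambda>x. 2 ^ (n - 2) * (x ^ (n - 2) * (1 - 2 * x) ^ n * indicator {0..1/2::real} x))"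
    by (auto simp: fun_eq_iff indicator_def power_mult_distrib)
  also have "(\<integral>x. 2 ^ (n - 2) * (x ^ (n - 2) * (1 - 2 * x) ^ n * indicator {0..1/2::real} x) \<partial>lborel) =
      2 ^ (n - 2) * (\<integral>x. (x ^ (n - 2) * (1 - 2 * x) ^ n) * indicator {0..1/2::real} x \<partial>lborel)"
    by simp
  finally have "Beta (real n - 1) (real n + 1) = (2 * 2 ^ (n - 2)) *
      (\<integral>x. (x ^ (n - 2) * (1 - 2 * x) ^ n) * indicator {0..1/2::real} x \<partial>lborel)"
    by simp
  also have "(2 * 2 ^ (n - 2) :: real) = 2 ^ (n - 1)"
    using assms by (simp flip: power_Suc add: Suc_diff_Suc numeral_2_eq_2)
  finally show ?thesis by simp
qed

text \<open>Write \<open>t ^ (2 * n - 1)\<close> as \<open>t ^ (n - 2) * t ^ n * t\<close> and put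
  \<open>x = r / t\<close>. The first factor normalises the binomial coefficient to
  \<open>x ^ (n - 2) / fact (n - 2)\<close>, the second normalises \<open>M (t - 2 * r)\<close> to
  \<open>V * (1 - 2 * x) ^ n\<close>, and the third is the mesh of a Riemann sum.\<close>

lemma weighted_sum_tendsto:
  fixes M :: "nat \<Rightarrow> real"
  assumes n: "n \<ge> 2" and M: "(\<lambda>m. M m / real m ^ n) \<longlonglongrightarrow> V"
  shows "(\<lambda>t. (\<Sum>r = 0..t div 2. real ((r + n - 2) choose (n - 2)) * M (t - 2 * r)) / real t ^ (2 * n - 1))
    \<longlonglongrightarrow> Beta (real n - 1) (real n + 1) / (fact (n - 2) * 2 ^ (n - 1)) * V"
proof -
  define k where "k = n - 2"
  obtain C where C: "\<And>m. \<bar>M m / real m ^ n\<bar> \<le> C"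
    using convergent_imp_Bseq[of "\<lambda>m. M m / real m ^ n"] M
    by (auto simp: Bseq_def convergent_def)
  \<comment> \<open>The bound \<open>C\<close> does not control \<open>M 0\<close>, because
    \<open>M 0 / 0 ^ n\<close> is 0 by division by zero. The index 0 occurs for
    \<open>t = 2 * r\<close>.\<close>
  define C' where "C' = C + \<bar>M 0\<bar>"
  have bound: "\<bar>M m / real t ^ n\<bar> \<le> C'" if "m \<le> t" "t > 0" for m t
  proof (cases "m = 0")
    case True
    have "0 \<le> C" using C[of 0] by linarith
    moreover have "\<bar>M 0\<bar> / real t ^ n \<le> \<bar>M 0\<bar> / 1"
      using that by (intro divide_left_mono) (auto simp: one_le_power)
    ultimately show ?thesis
      using True by (simp add: C'_def)
  next
    case False
    have "\<bar>M m / real t ^ n\<bar> \<le> \<bar>M m / real m ^ n\<bar>"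
      using that False by (auto simp: abs_divide intro!: divide_left_mono power_mono)
    also have "\<dots> \<le> C'" using C[of m] by (simp add: C'_def)
    finally show ?thesis .
  qed
  define h where "h = (\<lambda>t r. real ((r + k) choose k) / real t ^ k * (M (t - 2 * r) / real t ^ n))"
  \<comment> \<open>\<open>s t\<close> is the step function whose integral is the
    \<open>t\<close>-th Riemann sum of \<open>h\<close>, and \<open>f\<close> is its limit almost
    everywhere.\<close>
  define s where "s = (\<lambda>t x. if 0 \<le> x \<and> nat \<lfloor>real t * x\<rfloor> \<le> t div 2 then h t (nat \<lfloor>real t * x\<rfloor>) else 0)"
  define f where "f = (\<lambda>x. V / fact k * (x ^ k * (1 - 2 * x) ^ n * indicator {0..1/2::real} x))"
  have h_bound: "\<bar>h t r\<bar> \<le> (real k + 1) ^ k * C'" if "r \<le> t div 2" "t > 0" for t r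
    unfolding h_def abs_mult
    using that by (intro mult_mono bound) (auto intro!: binomial_over_power_le)
  \<comment> \<open>The two excluded points form a null set. At \<open>x = 1/2\<close> the argument
    \<open>t - 2 * r\<close> stays in {0, 1}, so the asymptotics of \<open>M\<close> give nothing
    there.\<close>
  have lim: "(\<lambda>t. s t x) \<longlonglongrightarrow> f x" if x: "x \<noteq> 0" "x \<noteq> 1/2" for x
  proof -
    consider "x < 0" | "0 < x" "x < 1/2" | "x > 1/2" using x by linarith
    then show ?thesis
    proof cases
      case 1
      then show ?thesis by (simp add: s_def f_def)
    next
      case 2
      let ?r = "\<lambda>t. nat \<lfloor>real t * x\<rfloor>"
      have r: "?r t \<le> t div 2" "real (2 * ?r t) \<le> 2 * x * real t" for t
      proof -
        have "0 \<le> real t * x" using 2 by simp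
        then have *: "real (?r t) \<le> real t * x" by (rule of_nat_floor)
        then show "real (2 * ?r t) \<le> 2 * x * real t"
          unfolding of_nat_mult by (simp only: mult.commute[of x] mult.assoc)
        have "real t * x \<le> real t * (1/2)" using 2 by (intro mult_left_mono) auto
        with * have "real (2 * ?r t) \<le> real t" unfolding of_nat_mult by linarith
        then have "2 * ?r t \<le> t" unfolding of_nat_le_iff .
        then show "?r t \<le> t div 2" by linarith
      qed
      have r_lim: "(\<lambda>t. real (?r t) / real t) \<longlonglongrightarrow> x"
      proof -
        have "(\<lambda>t. real (?r t) / real t - x) \<longlonglongrightarrow> 0"
        proof (rule Lim_null_comparison)
          show "eventually (\<lambda>t. norm (real (?r t) / real t - x) \<le> 1 / real t) sequentially"
            using eventually_gt_at_top[of 0]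
          proof eventually_elim
            case (elim t)
            have "real (?r t) / real t - x = (real (?r t) - real t * x) / real t"
              using elim by (simp add: field_simps)
            moreover have "\<bar>real (?r t) - real t * x\<bar> \<le> 1"
              using 2 by (simp add: abs_if) linarith
            ultimately show ?case by (simp add: divide_right_mono)
          qed
          show "(\<lambda>t. 1 / real t) \<longlonglongrightarrow> 0" by (rule lim_const_over_n)
        qed
        then show ?thesis by (simp add: LIM_zero_iff)
      qed
      have "2 * ?r t \<le> t" for t using r(1)[of t] by linarith
      then have m_eq: "real (t - 2 * ?r t) = real t - 2 * real (?r t)" for t
        by (simp add: of_nat_diff)
      have m_lim: "(\<lambda>t. real (t - 2 * ?r t) / real t) \<longlonglongrightarrow> 1 - 2 * x"
      proof -
        have "(\<lambda>t. 1 - 2 * (real (?r t) / real t)) \<longlonglongrightarrow> 1 - 2 * x"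
          by (intro tendsto_intros r_lim)
        moreover have "eventually (\<lambda>t. 1 - 2 * (real (?r t) / real t) = real (t - 2 * ?r t) / real t) sequentially"
          using eventually_gt_at_top[of 0] 
        proof eventually_elim
          case (elim t)
          then show ?case
            unfolding m_eq by (simp add: diff_divide_distrib)
        qed
        ultimately show ?thesis by (rule Lim_transform_eventually)
      qed
      \<comment> \<open>The argument of \<open>M\<close> is at least \<open>(1 - 2 * x) * t\<close>,
        so the hypothesis on \<open>M\<close> applies along it. Passing from the denominator
        \<open>(t - 2 * r) ^ n\<close> to \<open>t ^ n\<close> then produces the factor
        \<open>(1 - 2 * x) ^ n\<close>.\<close>
      have "filterlim (\<lambda>t. t - 2 * ?r t) at_top sequentially"
      proof -
        have "filterlim (\<lambda>t. (1 - 2 * x) * real t) at_top sequentially"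
          using 2 by (intro filterlim_tendsto_pos_mult_at_top[OF tendsto_const]) (auto simp: filterlim_real_sequentially)
        moreover have "(1 - 2 * x) * real t \<le> real (t - 2 * ?r t)" for t
          using r(2)[of t] by (simp add: m_eq algebra_simps)
        ultimately have "filterlim (\<lambda>t. real (t - 2 * ?r t)) at_top sequentially"
          by (auto intro: filterlim_at_top_mono)
        then show ?thesis
          by (simp add: filterlim_sequentially_iff_filterlim_real)
      qed
      then have Mm: "(\<lambda>t. M (t - 2 * ?r t) / real (t - 2 * ?r t) ^ n) \<longlonglongrightarrow> V"
        by (rule filterlim_compose[OF M])
      have pos: "t > 0 \<Longrightarrow> t - 2 * ?r t > 0" for t
      proof -
        assume "t > 0"
        then have "0 < (1 - 2 * x) * real t" using 2 by simp
        also have "\<dots> \<le> real (t - 2 * ?r t)"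
          using r(2)[of t] by (simp add: m_eq algebra_simps)
        finally show ?thesis by simp
      qed
      have "(\<lambda>t. M (t - 2 * ?r t) / real (t - 2 * ?r t) ^ n * (real (t - 2 * ?r t) / real t) ^ n) \<longlonglongrightarrow> V * (1 - 2 * x) ^ n"
        by (intro tendsto_mult Mm tendsto_power m_lim)
      moreover have "eventually (\<lambda>t. M (t - 2 * ?r t) / real (t - 2 * ?r t) ^ n * (real (t - 2 * ?r t) / real t) ^ n
          = M (t - 2 * ?r t) / real t ^ n) sequentially"
        using eventually_gt_at_top[of 0]
      proof eventually_elim
        case (elim t)
        then have "real (t - 2 * ?r t) ^ n \<noteq> 0" using pos[OF elim] by simp
        then show ?case
          by (simp add: power_divide del: of_nat_diff)
      qed
      ultimately have "(\<lambda>t. M (t - 2 * ?r t) / real t ^ n) \<longlonglongrightarrow> V * (1 - 2 * x) ^ n"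
        by (rule Lim_transform_eventually)
      then have "(\<lambda>t. h t (?r t)) \<longlonglongrightarrow> x ^ k / fact k * (V * (1 - 2 * x) ^ n)"
        unfolding h_def by (intro tendsto_mult binomial_over_power_tendsto r_lim)
      moreover have "s t x = h t (?r t)" for t
        using 2 r(1)[of t] by (simp add: s_def)
      ultimately show ?thesis
        using 2 by (simp add: f_def mult_ac)
    next
      case 3
      have "eventually (\<lambda>t. s t x = 0) sequentially"
      proof -
        have "filterlim (\<lambda>t. (x - 1/2) * real t) at_top sequentially"
          using 3 by (intro filterlim_tendsto_pos_mult_at_top[OF tendsto_const]) (auto simp: filterlim_real_sequentially)
        then have "eventually (\<lambda>t. (x - 1/2) * real t \<ge> 2) sequentially"
          by (simp add: filterlim_at_top)
        then show ?thesis
        proof eventually_elim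
          case (elim t)
          then have "t div 2 < nat \<lfloor>real t * x\<rfloor>"
            by (simp add: algebra_simps) linarith
          then show ?case by (simp add: s_def)
        qed
      qed
      then show ?thesis
        using 3 by (simp add: f_def tendsto_eventually)
    qed
  qed
  have s_meas: "s t \<in> borel_measurable lborel" for t
  proof -
    have "(\<lambda>x. nat \<lfloor>real t * x\<rfloor>) \<in> measurable borel (count_space UNIV)"
      by measurable
    moreover have "h t \<in> borel_measurable (count_space UNIV)" by simp
    ultimately have [measurable]: "(\<lambda>x. h t (nat \<lfloor>real t * x\<rfloor>)) \<in> borel_measurable borel"
      by (rule measurable_compose)
    show ?thesis unfolding s_def by measurable
  qed
  have "(\<lambda>t. \<integral>x. s (Suc t) x \<partial>lborel) \<longlonglongrightarrow> (\<integral>x. f x \<partial>lborel)"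
  proof (rule integral_dominated_convergence)
    show "f \<in> borel_measurable lborel" unfolding f_def by measurable
    show "s (Suc t) \<in> borel_measurable lborel" for t by (rule s_meas)
    \<comment> \<open>The step functions overshoot 1/2 slightly: on their support
      \<open>t * x < t / 2 + 1\<close>, which is at most \<open>2 * t\<close> for
      \<open>t \<ge> 1\<close>.\<close>
    show "integrable lborel (\<lambda>x. (real k + 1) ^ k * C' * indicator {0..2::real} x)"
      by (intro integrable_mult_right integrable_real_indicator) auto
    show "AE x in lborel. (\<lambda>t. s (Suc t) x) \<longlonglongrightarrow> f x"
      using AE_lborel_singleton[of "0::real"] AE_lborel_singleton[of "1/2::real"]
      by eventually_elim (intro LIMSEQ_Suc lim)
    show "AE x in lborel. norm (s (Suc t) x) \<le> (real k + 1) ^ k * C' * indicator {0..2::real} x" for t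
    proof (rule AE_I2)
      fix x :: real
      show "norm (s (Suc t) x) \<le> (real k + 1) ^ k * C' * indicator {0..2::real} x"
      proof (cases "0 \<le> x \<and> nat \<lfloor>real (Suc t) * x\<rfloor> \<le> Suc t div 2")
        case True
        then have "real (Suc t) * x \<le> real (Suc t) * 2"
          by (simp add: nat_le_iff floor_le_iff) linarith
        then have "x \<le> 2" by (rule mult_left_le_imp_le) simp
        then show ?thesis
          using True h_bound[of "nat \<lfloor>real (Suc t) * x\<rfloor>" "Suc t"]
          by (simp add: s_def del: of_nat_Suc)
      next
        case False
        have "0 \<le> C'" using bound[of 1 1] by linarith
        then show ?thesis using False by (auto simp: s_def simp del: of_nat_Suc)
      qed
    qed
  qed
  also have "(\<integral>x. f x \<partial>lborel) =
      V / fact k * (\<integral>x. (x ^ k * (1 - 2 * x) ^ n) * indicator {0..1/2::real} x \<partial>lborel)"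
    unfolding f_def by (rule Bochner_Integration.integral_mult_right_zero)
  also have "\<dots> = V / fact k * (Beta (real n - 1) (real n + 1) / 2 ^ (n - 1))"
    unfolding k_def by (simp only: integral_Beta_half[OF n])
  also have "\<dots> = Beta (real n - 1) (real n + 1) / (fact (n - 2) * 2 ^ (n - 1)) * V"
    by (simp add: k_def)
  also have "(\<lambda>t. \<integral>x. s (Suc t) x \<partial>lborel) = (\<lambda>t. (\<Sum>r = 0..Suc t div 2. h (Suc t) r) / real (Suc t))"
    unfolding s_def by (subst Riemann_sum_eq_integral) simp_all
  finally have "(\<lambda>t. (\<Sum>r = 0..t div 2. h t r) / real t)
      \<longlonglongrightarrow> Beta (real n - 1) (real n + 1) / (fact (n - 2) * 2 ^ (n - 1)) * V"
    by (rule LIMSEQ_imp_Suc)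
  moreover have "(\<Sum>r = 0..t div 2. h t r) / real t =
      (\<Sum>r = 0..t div 2. real ((r + n - 2) choose (n - 2)) * M (t - 2 * r)) / real t ^ (2 * n - 1)" for t
  proof -
    have e: "2 * n - 1 = k + n + 1" "\<And>r. r + n - 2 = r + k"
      using n by (auto simp: k_def)
    show ?thesis
      unfolding k_def[symmetric] e h_def sum_divide_distrib
      by (intro sum.cong refl) (simp add: power_add)
  qed
  ultimately show ?thesis by simp
qed

subsection \<open>Asymptotics of the harmonic count\<close>

lemma l1_norm_int_vec: "\<exists>s. l1_norm (int_vec z) = real s"
proof
  show "l1_norm (int_vec z) = real (nat (\<Sum>i\<in>UNIV. \<bar>z $ i\<bar>))"
    by (simp add: l1_norm_def int_vec_def sum_nonneg)
qed

lemma finite_l1_norm_le: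
  fixes L :: "(real ^ 'n) set"
  assumes "L \<subseteq> range int_vec"
  shows "finite {x \<in> L. l1_norm x \<le> c}"
proof -
  have "bounded {x :: real ^ 'n. l1_norm x \<le> c}"
    using norm_le_l1_norm by (auto simp: bounded_iff intro: order_trans)
  then have "finite (int_vec ` {z :: int ^ 'n. int_vec z \<in> {x. l1_norm x \<le> c}})"
    by (intro finite_imageI finite_int_vec_bounded)
  then show ?thesis
    by (rule rev_finite_subset) (use assms in auto)
qed

text \<open>Integer vectors have natural numbers as \<open>l1_norm\<close>, so the spheres of
  integer radius exhaust the ball.\<close>

lemma sum_norm_count:
  fixes L :: "(real ^ 'n) set"
  assumes "L \<subseteq> range int_vec"
  shows "(\<Sum>s = 0..m. norm_count L s) = card {x \<in> L. l1_norm x \<le> real m}"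
proof -
  have fin: "finite {x \<in> L. l1_norm x = real s}" for s
    by (rule finite_subset[OF _ finite_l1_norm_le[OF assms, of "real s"]]) auto
  have "{x \<in> L. l1_norm x \<le> real m} = (\<Union>s\<in>{0..m}. {x \<in> L. l1_norm x = real s})"
  proof (intro set_eqI iffI)
    fix x assume x: "x \<in> {x \<in> L. l1_norm x \<le> real m}"
    then obtain s where "l1_norm x = real s"
      using assms l1_norm_int_vec by blast
    then show "x \<in> (\<Union>s\<in>{0..m}. {x \<in> L. l1_norm x = real s})"
      using x by auto
  qed auto
  also have "card \<dots> = (\<Sum>s\<in>{0..m}. card {x \<in> L. l1_norm x = real s})"
    using fin by (intro card_UN_disjoint) auto
  finally show ?thesis
    by (simp add: norm_count_def)
qed

text \<open>With \<open>u = s - 2 * r\<close> and \<open>r\<close> fixed, \<open>u\<close> runs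
  through \<open>0..t - 2 * r\<close>, so the sphere counts add up to a ball count.\<close>

lemma harmonic_count_eq:
  fixes L :: "(real ^ 'n) set"
  assumes "L \<subseteq> range int_vec"
  shows "harmonic_count L t = (\<Sum>r = 0..t div 2.
    ((r + CARD('n) - 2) choose (CARD('n) - 2)) * card {x \<in> L. l1_norm x \<le> real (t - 2 * r)})"
proof -
  let ?b = "\<lambda>r. (r + CARD('n) - 2) choose (CARD('n) - 2)"
  have "harmonic_count L t = (\<Sum>(s, r)\<in>(SIGMA s:{0..t}. {0..s div 2}). ?b r * norm_count L (s - 2 * r))"
    unfolding harmonic_count_def by (subst sum.Sigma) auto
  also have "\<dots> = (\<Sum>(r, u)\<in>(SIGMA r:{0..t div 2}. {0..t - 2 * r}). ?b r * norm_count L u)"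
    by (rule sum.reindex_bij_witness[of _ "\<lambda>(r, u). (u + 2 * r, r)" "\<lambda>(s, r). (r, s - 2 * r)"]) auto
  also have "\<dots> = (\<Sum>r = 0..t div 2. \<Sum>u = 0..t - 2 * r. ?b r * norm_count L u)"
    by (subst sum.Sigma) auto
  finally show ?thesis
    by (simp add: sum_distrib_left[symmetric] sum_norm_count[OF assms])
qed

lemma inj_int_vec: "inj int_vec"
  by (auto simp: inj_def int_vec_def vec_eq_iff)

lemma int_vec_in_congruence_lattice:
  "int_vec (\<chi> j. q * z $ j) \<in> congruence_lattice q p"
proof -
  have "(\<Sum>j\<in>UNIV. (\<chi> j. q * z $ j) $ j * p $ j) = q * (\<Sum>j\<in>UNIV. z $ j * p $ j)"
    by (simp add: sum_distrib_left mult.assoc)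
  then have "[(\<Sum>j\<in>UNIV. (\<chi> j. q * z $ j) $ j * p $ j) = 0] (mod q)"
    by (simp add: cong_0_iff)
  then show ?thesis unfolding congruence_lattice_def by blast
qed

lemma generating_matrix_range:
  assumes "generating_matrix A T"
  shows "T = range (\<lambda>z. A *v int_vec z)"
proof -
  have "(\<Sum>j\<in>UNIV. real_of_int (z $ j) *\<^sub>R column j A) = A *v int_vec z" for z
    by (simp add: matrix_mult_sum int_vec_def scalar_mult_eq_scaleR)
  then show ?thesis
    using assms by (simp add: generating_matrix_def bij_betw_def)
qed

text \<open>\<open>T\<close> contains \<open>q\<close> times every unit vector. Dividing by
  \<open>q\<close> puts the unit vectors into the range of \<open>A\<close>, which is therefore
  everything.\<close>

lemma generating_matrix_invertible:
  fixes A :: "real ^ 'n ^ 'n"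
  assumes q: "q > 0" and gen: "generating_matrix A (congruence_lattice q p)"
  shows "invertible A"
proof -
  have "axis i 1 \<in> range ((*v) A)" for i :: 'n
  proof -
    have "int_vec (\<chi> j. q * axis i 1 $ j) \<in> range (\<lambda>z. A *v int_vec z)"
      using generating_matrix_range[OF gen] int_vec_in_congruence_lattice by metis
    then obtain z where z: "int_vec (\<chi> j. q * axis i 1 $ j) = A *v int_vec z" by auto
    have e:  "int_vec (\<chi> j. q * axis i 1 $ j) = real_of_int q *\<^sub>R axis i 1"
      by (simp add: int_vec_def vec_eq_iff axis_def)
    have "A *v (int_vec z /\<^sub>R real_of_int q) = axis i 1"
      unfolding matrix_vector_mult_scaleR z[symmetric] e using q by simp
    then have "axis i 1 = A *v (int_vec z /\<^sub>R real_of_int q)" ..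
    then show ?thesis by blast
  qed
  then have "Basis \<subseteq> range ((*v) A)"
    by (auto simp: Basis_vec_def)
  moreover have "subspace (range ((*v) A))"
    by (intro linear_subspace_image matrix_vector_mul_linear subspace_UNIV)
  ultimately have "span Basis \<subseteq> range ((*v) A)"
    by (rule span_minimal)
  then have "surj ((*v) A)" by auto
  then show ?thesis
    by (metis invertible_right_inverse matrix_right_invertible_surjective)
qed

text \<open>Lets one set be treated as a preimage for measurability, frontiers and scaling of
  volumes, and as a linear image for boundedness and negligibility.\<close>

lemma matrix_inv_image:
  fixes A :: "real ^ 'n ^ 'n"
  assumes "invertible A"
  shows "(*v) (matrix_inv A) ` S = (*v) A -` S"
proof -
  have "A ** matrix_inv A = mat 1" "matrix_inv A ** A = mat 1"
    using assms someI_ex[of "\<lambda>A'. A ** A' = mat 1 \<and> A' ** A = mat 1"]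
    by (auto simp: invertible_def matrix_inv_def)
  then have "A *v (matrix_inv A *v x) = x" "matrix_inv A *v (A *v x) = x" for x
    by (simp_all add: matrix_vector_mul_assoc)
  then show ?thesis by (auto intro!: rev_image_eqI)
qed

lemma frontier_vimage_subset:
  assumes "continuous_on UNIV f"
  shows "frontier (f -` S) \<subseteq> f -` frontier S"
proof -
  have "closure (f -` X) \<subseteq> f -` closure X" for X
    using assms closure_subset[of X] by (intro closure_minimal closed_vimage) auto
  from this[of S] this[of "- S"] show ?thesis
    by (auto simp: frontier_closures vimage_Compl)
qed

lemma harmonic_count_tendsto:
  fixes A :: "real ^ 'n ^ 'n" and T U :: "(real ^ 'n) set"
  assumes n: "CARD('n) \<ge> 2"
    and inv: "invertible A" and T: "T = range (\<lambda>z. A *v int_vec z)" and T_int: "T \<subseteq> range int_vec"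
    and U: "U \<in> sets borel" "U \<subseteq> sphere 0 1" and fr: "negligible (frontier (cone_over U))"
  shows "(\<lambda>t. real (harmonic_count (T \<inter> cone_over U) t) / real t ^ (2 * CARD('n) - 1)) \<longlonglongrightarrow>
    Beta (real CARD('n) - 1) (real CARD('n) + 1) / (fact (CARD('n) - 2) * 2 ^ (CARD('n) - 1))
      * measure lebesgue ((*v) A -` (cone_over U \<inter> l1_unit_ball))"
proof -
  define E where "E = cone_over U \<inter> l1_unit_ball"
  define D where "D = (*v) A -` E"
  have cont: "continuous_on S ((*v) A)" for S
    by (intro linear_continuous_on) (simp add: linear_conv_bounded_linear[symmetric])
  have E_borel: "E \<in> sets borel"
    unfolding E_def using cone_over_borel[OF U(2,1)] l1_unit_ball_borel by auto
  have D_borel: "D \<in> sets borel"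
    using measurable_sets[OF borel_measurable_continuous_onI[OF cont] E_borel] by (simp add: D_def)
  have D_bounded: "bounded D"
    unfolding D_def matrix_inv_image[OF inv, symmetric] E_def
    by (intro bounded_linear_image bounded_Int disjI2 bounded_l1_unit_ball)
       (simp add: linear_conv_bounded_linear[symmetric])
  \<comment> \<open>The frontier of \<open>E\<close> is covered by those of the cone and of the
    convex ball, both null, and the inverse linear map keeps null sets null.\<close>
  have "frontier D \<subseteq> (*v) A -` frontier E"
    unfolding D_def by (rule frontier_vimage_subset[OF cont])
  moreover have "negligible (frontier E)"
    unfolding E_def
    by (rule negligible_subset[OF _ frontier_Int_subset]) (simp add: fr negligible_frontier_l1_unit_ball)
  then have "negligible ((*v) A -` frontier E)"
    unfolding matrix_inv_image[OF inv, symmetric]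
    by (intro negligible_differentiable_image_negligible)
       (auto intro: linear_imp_differentiable_on)
  ultimately have D_fr: "negligible (frontier D)"
    using negligible_subset by blast
  define M where "M m = real (card {x \<in> T \<inter> cone_over U. l1_norm x \<le> real m})" for m
  \<comment> \<open>The cone is stable under dilation by \<open>1 / m\<close>, so \<open>A\<close>
    matches the integer points of the \<open>m\<close>-fold dilate of \<open>D\<close> with the
    lattice points of the cone of \<open>l1_norm\<close> at most \<open>m\<close>.\<close>
  have M_eq: "M m = real (card {z. int_vec z /\<^sub>R real m \<in> D})" if "m > 0" for m
  proof -
    have "{x \<in> T \<inter> cone_over U. l1_norm x \<le> real m} = (\<lambda>z. A *v int_vec z) ` {z. int_vec z /\<^sub>R real m \<in> D}"
    proof -
      have "int_vec z /\<^sub>R real m \<in> D \<longleftrightarrow> A *v int_vec z \<in> cone_over U \<and> l1_norm (A *v int_vec z) \<le> real m" for z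
        using that scaleR_mem_cone_over[of "inverse (real m)" "A *v int_vec z" U]
        by (simp add: D_def E_def matrix_vector_mult_scaleR l1_unit_ball_def l1_norm_scaleR field_simps)
      then show ?thesis by (auto simp: T)
    qed
    moreover have "inj (\<lambda>z. A *v int_vec z)"
      using inj_compose[OF inj_matrix_vector_mult[OF inv] inj_int_vec] by (simp add: o_def)
    ultimately show ?thesis
      unfolding M_def using card_image[OF inj_on_subset[OF _ subset_UNIV]] by simp
  qed
  have "(\<lambda>m. real (card {z :: int ^ 'n. int_vec z /\<^sub>R real m \<in> D}) / real m ^ CARD('n)) \<longlonglongrightarrow> measure lebesgue D"
    by (rule lattice_point_asymptotics[OF D_bounded D_borel D_fr])
  moreover have "eventually (\<lambda>m. real (card {z :: int ^ 'n. int_vec z /\<^sub>R real m \<in> D}) / real m ^ CARD('n) = M m / real m ^ CARD('n)) sequentially"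
    using eventually_gt_at_top[of 0] by eventually_elim (simp add: M_eq)
  ultimately have "(\<lambda>m. M m / real m ^ CARD('n)) \<longlonglongrightarrow> measure lebesgue D"
    by (rule Lim_transform_eventually)
  from weighted_sum_tendsto[OF n this] show ?thesis
    using T_int by (subst harmonic_count_eq) (auto simp: M_def D_def E_def)
qed

subsection \<open>The harmonic counting measure\<close>

lemma sets_sphere_iff:
  "U \<in> sets (restrict_space borel (sphere 0 1)) \<longleftrightarrow> U \<in> sets borel \<and> U \<subseteq> sphere (0 :: real ^ 'n) 1"
  by (auto simp: sets_restrict_space_iff)

text \<open>The radial projection to the sphere of Lebesgue measure on the \<open>l1\<close>-ball,
  scaled by \<open>c\<close>. As an image measure it is countably additive by construction. The
  origin is removed because \<open>sgn 0 = 0\<close> is not on the sphere.\<close>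

definition cone_measure :: "real \<Rightarrow> (real ^ 'n) measure" where
  "cone_measure c = scale_measure (ennreal c)
     (distr (restrict_space lborel (l1_unit_ball - {0})) (restrict_space borel (sphere 0 1)) sgn)"

lemma sets_cone_measure: "sets (cone_measure c) = sets (restrict_space borel (sphere 0 1))"
  by (simp add: cone_measure_def)

lemma emeasure_cone_measure:
  fixes U :: "(real ^ 'n) set"
  assumes "U \<in> sets borel" "U \<subseteq> sphere 0 1"
  shows "emeasure (cone_measure c) U = ennreal c * emeasure lborel (cone_over U \<inter> l1_unit_ball)"
proof -
  let ?B = "l1_unit_ball - {0} :: (real ^ 'n) set"
  have B: "?B \<in> sets borel" using l1_unit_ball_borel by auto
  have meas: "sgn \<in> measurable (restrict_space lborel ?B) (restrict_space borel (sphere 0 1))"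
    by (intro measurable_restrict_space2 measurable_restrict_space1)
       (auto simp: space_restrict_space norm_sgn)
  have U: "U \<in> sets (restrict_space borel (sphere 0 1))"
    using assms sets_sphere_iff by blast
  have "sgn -` U \<inter> space (restrict_space lborel ?B) = cone_over U \<inter> l1_unit_ball - {0}"
    using cone_over_iff[OF assms(2)] by (auto simp: space_restrict_space)
  then have "emeasure (cone_measure c) U =
      ennreal c * emeasure (restrict_space lborel ?B) (cone_over U \<inter> l1_unit_ball - {0})"
    unfolding cone_measure_def emeasure_scale_measure emeasure_distr[OF meas U] by simp
  also have "emeasure (restrict_space lborel ?B) (cone_over U \<inter> l1_unit_ball - {0}) =
      emeasure lborel (cone_over U \<inter> l1_unit_ball - {0})"
    using B by (intro emeasure_restrict_space) auto
  also have "\<dots> = emeasure lborel (cone_over U \<inter> l1_unit_ball)"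
    using cone_over_borel[OF assms(2,1)] l1_unit_ball_borel
    by (intro emeasure_Diff_null_set) (auto simp: null_sets_def)
  finally show ?thesis .
qed

section \<open>Invariance under changes of signs of the coordinates\<close>

definition flip :: "real ^ 'n \<Rightarrow> real ^ 'n \<Rightarrow> real ^ 'n" where
  "flip \<sigma> x = (\<chi> i. \<sigma> $ i * x $ i)"

context
  fixes \<sigma> :: "real ^ 'n"
  assumes \<sigma>: "\<forall>i. \<sigma> $ i \<in> {1, - 1}"
begin

lemma flip_flip: "flip \<sigma> (flip \<sigma> x) = x"
proof -
  have "\<sigma> $ i * (\<sigma> $ i * x $ i) = x $ i" for i
    using spec[OF \<sigma>, of i] by auto
  then show ?thesis by (simp add: flip_def vec_eq_iff)
qed

lemma abs_flip: "\<bar>flip \<sigma> x $ i\<bar> = \<bar>x $ i\<bar>"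
  using spec[OF \<sigma>, of i] by (auto simp: flip_def abs_mult)

lemma norm_flip: "norm (flip \<sigma> x) = norm x"
  using abs_flip[of x] by (simp add: norm_vec_def)

lemma l1_norm_flip: "l1_norm (flip \<sigma> x) = l1_norm x"
  by (simp add: l1_norm_def abs_flip)

lemma linear_flip: "linear (flip \<sigma>)"
  by (rule linearI) (auto simp: flip_def vec_eq_iff algebra_simps)

lemma flip_image: "flip \<sigma> ` S = flip \<sigma> -` S"
  using flip_flip by (force intro: rev_image_eqI)

lemma flip_borel: "S \<in> sets borel \<Longrightarrow> flip \<sigma> ` S \<in> sets borel"
  unfolding flip_image
  using measurable_sets[OF borel_measurable_continuous_onI[OF linear_continuous_on], of "flip \<sigma>" S]
    linear_flip by (simp add: linear_conv_bounded_linear)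

lemma cone_over_flip: "cone_over (flip \<sigma> ` U) = flip \<sigma> ` cone_over U"
proof -
  have *: "flip \<sigma> (t *\<^sub>R x) = t *\<^sub>R flip \<sigma> x" for t x
    by (rule linear_cmul[OF linear_flip])
  show ?thesis
  proof (intro equalityI subsetI)
    fix y assume "y \<in> cone_over (flip \<sigma> ` U)"
    then obtain t x where "y = t *\<^sub>R flip \<sigma> x" "t \<ge> 0" "x \<in> U"
      unfolding cone_over_def by blast
    then show "y \<in> flip \<sigma> ` cone_over U"
      unfolding *[symmetric] cone_over_def by blast
  next
    fix y assume "y \<in> flip \<sigma> ` cone_over U"
    then obtain t x where "y = flip \<sigma> (t *\<^sub>R x)" "t \<ge> 0" "x \<in> U"
      unfolding cone_over_def by blast
    then show "y \<in> cone_over (flip \<sigma> ` U)"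
      unfolding * cone_over_def by blast
  qed
qed

text \<open>The factor by which \<open>flip \<sigma>\<close> scales volumes is read off from the
  unit ball, which it preserves and whose volume is positive and finite.\<close>

lemma emeasure_lborel_flip:
  assumes "S \<in> sets borel"
  shows "emeasure lborel (flip \<sigma> ` S) = emeasure lborel S"
proof -
  have "bij (flip \<sigma>)" using flip_flip by (intro bijI') metis+
  then obtain c where c: "c \<ge> 0"
    "\<And>S. S \<in> sets borel \<Longrightarrow> emeasure lborel (flip \<sigma> -` S) = ennreal c * emeasure lborel S"
    using emeasure_linear_vimage[OF linear_flip] by metis
  let ?b = "ball 0 1 :: (real ^ 'n) set"
  have "flip \<sigma> -` ?b = ?b" by (auto simp: norm_flip)
  then have "emeasure lborel ?b = ennreal c * emeasure lborel ?b"
    using c(2)[of ?b] by simp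
  then have "ennreal (measure lborel ?b) = ennreal c * ennreal (measure lborel ?b)"
    using emeasure_lborel_ball_finite[of "0 :: real ^ 'n" 1] by (simp add: emeasure_eq_ennreal_measure)
  then have "measure lborel ?b = c * measure lborel ?b"
    using c(1) by (simp flip: ennreal_mult)
  moreover have "measure lborel ?b > 0" using content_ball_pos[of 1 "0 :: real ^ 'n"] by simp
  ultimately have "c = 1" by simp
  then show ?thesis using c(2)[OF assms] by (simp add: flip_image)
qed

lemma emeasure_cone_measure_flip:
  assumes "U \<in> sets borel" "U \<subseteq> sphere 0 1"
  shows "emeasure (cone_measure c) (flip \<sigma> ` U) = emeasure (cone_measure c) U"
proof -
  have "flip \<sigma> ` U \<subseteq> sphere 0 1"
    using assms(2) by (auto simp: norm_flip)
  moreover have "flip \<sigma> ` cone_over U \<inter> l1_unit_ball = flip \<sigma> ` (cone_over U \<inter> l1_unit_ball)"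
    by (auto simp: l1_unit_ball_def l1_norm_flip)
  moreover have "cone_over U \<inter> l1_unit_ball \<in> sets borel"
    using cone_over_borel[OF assms(2,1)] l1_unit_ball_borel by auto
  ultimately show ?thesis
    using assms by (simp add: emeasure_cone_measure flip_borel cone_over_flip emeasure_lborel_flip)
qed

end

section \<open>Caps of the orthant and uniqueness of the measure\<close>

definition orthant_cap :: "real ^ 'n \<Rightarrow> (real ^ 'n) set" where
  "orthant_cap a = {x \<in> sphere 0 1 \<inter> nonneg_orthant. x /\<^sub>R l1_norm x \<le> a}"

lemma closed_nonneg_orthant: "closed (nonneg_orthant :: (real ^ 'n) set)"
  unfolding nonneg_orthant_def Collect_all_eq
  by (intro closed_INT ballI closed_Collect_le continuous_intros)

lemma orthant_cap_borel:
  fixes a :: "real ^ 'n"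
  shows "orthant_cap a \<in> sets borel"
proof -
  have "(\<lambda>x :: real ^ 'n. x /\<^sub>R l1_norm x) \<in> borel_measurable borel"
    by measurable
  then have "(\<lambda>x :: real ^ 'n. x /\<^sub>R l1_norm x) -` {..a} \<in> sets borel"
    using measurable_sets[of _ borel borel "{..a}"] by fastforce
  moreover have "orthant_cap a = sphere 0 1 \<inter> nonneg_orthant \<inter> (\<lambda>x. x /\<^sub>R l1_norm x) -` {..a}"
    by (auto simp: orthant_cap_def)
  moreover have "sphere 0 1 \<inter> (nonneg_orthant :: (real ^ 'n) set) \<in> sets borel"
    by (intro borel_closed closed_Int closed_sphere closed_nonneg_orthant)
  ultimately show ?thesis
    by (simp only: sets.Int)
qed

text \<open>On the orthant \<open>l1_norm\<close> is the sum of the coordinates, so the cap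
  conditions become homogeneous linear inequalities. They cut out a convex set \<open>K\<close>, and
  convex sets have null frontiers.\<close>

lemma orthant_cap_cone:
  fixes a :: "real ^ 'n"
  shows "cone_over (orthant_cap a) \<subseteq> nonneg_orthant"
    and "negligible (frontier (cone_over (orthant_cap a)))"
proof -
  show "cone_over (orthant_cap a) \<subseteq> nonneg_orthant"
    by (auto simp: cone_over_def orthant_cap_def nonneg_orthant_def)
  define K where "K = {x :: real ^ 'n. (\<forall>i. 0 \<le> x $ i) \<and> (\<forall>i. x $ i \<le> a $ i * (\<Sum>j\<in>UNIV. x $ j))}"
  have K_iff: "x \<in> cone_over (orthant_cap a) \<longleftrightarrow> x \<in> K" if "x \<noteq> 0" for x
  proof -
    have pos: "0 < l1_norm x" by (rule l1_norm_pos[OF that])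
    have "sgn x /\<^sub>R l1_norm (sgn x) = x /\<^sub>R l1_norm x"
      using that by (simp add: sgn_div_norm l1_norm_scaleR)
    then have "sgn x \<in> orthant_cap a \<longleftrightarrow> (\<forall>i. 0 \<le> x $ i) \<and> x /\<^sub>R l1_norm x \<le> a"
      using that by (simp add: orthant_cap_def nonneg_orthant_def norm_sgn)
        (simp add: sgn_div_norm zero_le_mult_iff zero_le_divide_iff)
    also have "\<dots> \<longleftrightarrow> x \<in> K"
    proof (cases "\<forall>i. 0 \<le> x $ i")
      case True
      then have l: "l1_norm x = (\<Sum>j\<in>UNIV. x $ j)" by (simp add: l1_norm_def)
      show ?thesis
        using True pos unfolding K_def l
        by (simp add: less_eq_vec_def pos_divide_le_eq divide_inverse_commute[symmetric])
    qed (auto simp: K_def)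
    finally show ?thesis
      using cone_over_iff[of "orthant_cap a" x] that by (simp add: orthant_cap_def subset_eq)
  qed
  \<comment> \<open>An empty cap has an empty cone, whereas \<open>K\<close> always contains the
    origin.\<close>
  have "cone_over (orthant_cap a) = {} \<or> cone_over (orthant_cap a) = K"
  proof (cases "orthant_cap a = {}")
    case True
    then show ?thesis by (simp add: cone_over_def)
  next
    case False
    have "0 \<in> K" by (simp add: K_def)
    then have "x \<in> cone_over (orthant_cap a) \<longleftrightarrow> x \<in> K" for x
      using False K_iff[of x] zero_mem_cone_over[of "orthant_cap a"] by (cases "x = 0") auto
    then show ?thesis by blast
  qed
  moreover have "convex K"
  proof -
    have one: "(1 :: real ^ 'n) \<bullet> x = (\<Sum>j\<in>UNIV. x $ j)" for x
      by (simp add: inner_vec_def)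
    have "K = (\<Inter>i. {x. 0 \<le> x $ i}) \<inter> (\<Inter>i. {x. (axis i 1 - a $ i *\<^sub>R 1) \<bullet> x \<le> 0})"
      by (auto simp: K_def inner_diff_left inner_axis' one)
    moreover have "{x. 0 \<le> x $ i} = {x :: real ^ 'n. axis i 1 \<bullet> x \<ge> 0}" for i
      by (simp add: inner_axis')
    ultimately show ?thesis
      by (auto intro!: convex_Int convex_INT convex_halfspace_le convex_halfspace_ge)
  qed
  ultimately show "negligible (frontier (cone_over (orthant_cap a)))"
    by (auto intro: negligible_convex_frontier)
qed

text \<open>Pushed forward along \<open>x /\<^sub>R l1_norm x\<close>, the caps become the sets
  \<open>{..a}\<close>, which are stable under intersection and generate the Borel sets. The cubes
  with integer corners give the required exhaustion by sets of finite measure.\<close>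

lemma measure_eqI_orthant_cap:
  fixes \<mu> \<nu> :: "(real ^ 'n) measure" and U :: "(real ^ 'n) set"
  assumes sets: "sets \<mu> = sets (restrict_space borel (sphere 0 1))"
      "sets \<nu> = sets (restrict_space borel (sphere 0 1))"
    and eq: "\<And>a. emeasure \<mu> (orthant_cap a) = emeasure \<nu> (orthant_cap a)"
    and fin: "\<And>a. emeasure \<mu> (orthant_cap a) < \<infinity>"
    and U: "U \<in> sets borel" "U \<subseteq> sphere 0 1 \<inter> nonneg_orthant"
  shows "emeasure \<mu> U = emeasure \<nu> U"
proof -
  let ?O = "sphere 0 1 \<inter> nonneg_orthant :: (real ^ 'n) set"
  let ?g = "\<lambda>x :: real ^ 'n. x /\<^sub>R l1_norm x"
  have O: "?O \<in> sets borel" using borel_closed[OF closed_nonneg_orthant] by auto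
  have g: "?g \<in> borel_measurable borel" by measurable
  define D where "D \<kappa> = distr (restrict_space \<kappa> ?O) borel ?g" for \<kappa> :: "(real ^ 'n) measure"
  have D: "emeasure (D \<kappa>) S = emeasure \<kappa> (?O \<inter> ?g -` S)"
    if \<kappa>: "sets \<kappa> = sets (restrict_space borel (sphere 0 1))" and S: "S \<in> sets borel" for \<kappa> S
  proof -
    have sp: "space \<kappa> = sphere 0 1"
      using sets_eq_imp_space_eq[OF \<kappa>] by (simp add: space_restrict_space)
    have O_\<kappa>: "?O \<in> sets \<kappa>" unfolding \<kappa> sets_sphere_iff using O by auto
    have "?g \<in> measurable (restrict_space borel (sphere 0 1)) borel"
      by (rule measurable_restrict_space1[OF g])
    then have "?g \<in> borel_measurable \<kappa>" using measurable_cong_sets[OF \<kappa> refl] by blast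
    then have "?g \<in> borel_measurable (restrict_space \<kappa> ?O)" by (rule measurable_restrict_space1)
    then have "emeasure (D \<kappa>) S = emeasure (restrict_space \<kappa> ?O) (?g -` S \<inter> space (restrict_space \<kappa> ?O))"
      unfolding D_def using S by (rule emeasure_distr)
    also have "?g -` S \<inter> space (restrict_space \<kappa> ?O) = ?O \<inter> ?g -` S"
      by (auto simp: space_restrict_space sp)
    also have "emeasure (restrict_space \<kappa> ?O) \<dots> = emeasure \<kappa> \<dots>"
      using O_\<kappa> by (intro emeasure_restrict_space) (auto simp: sp Int_commute Int_left_commute)
    finally show ?thesis .
  qed
  have cap: "?O \<inter> ?g -` {..a} = orthant_cap a" for a
    by (auto simp: orthant_cap_def)
  have borel: "sets borel = sigma_sets UNIV (range (\<lambda>a. {..a :: real ^ 'n}))"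
    unfolding borel_eq_atMost by (rule sets_measure_of) simp
  have "D \<mu> = D \<nu>"
  proof (rule measure_eqI_generator_eq)
    show "Int_stable (range (\<lambda>a. {..a :: real ^ 'n}))"
    proof -
      have "{..a} \<inter> {..b} = {..inf a b}" for a b :: "real ^ 'n" by auto
      then show ?thesis by (auto simp: Int_stable_def)
    qed
    show "range (\<lambda>a. {..a :: real ^ 'n}) \<subseteq> Pow UNIV" by simp
    show "sets (D \<mu>) = sigma_sets UNIV (range (\<lambda>a. {..a}))" "sets (D \<nu>) = sigma_sets UNIV (range (\<lambda>a. {..a}))"
      by (simp_all add: D_def borel)
    show "emeasure (D \<mu>) X = emeasure (D \<nu>) X" if "X \<in> range (\<lambda>a. {..a})" for X
      using that by (auto simp: D sets cap eq)
    show "range (\<lambda>n. {..\<chi> i. real n}) \<subseteq> range (\<lambda>a. {..a :: real ^ 'n})" by auto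
    show "(\<Union>n. {..(\<chi> i. real n) :: real ^ 'n}) = UNIV"
    proof -
      have "\<exists>n. x \<le> (\<chi> i. real n)" for x :: "real ^ 'n"
      proof -
        obtain n where "norm x \<le> real n" using real_arch_simple by blast
        then have "x $ i \<le> real n" for i
          using component_le_norm_cart[of x i] by linarith
        then show ?thesis by (auto simp: less_eq_vec_def)
      qed
      then show ?thesis by auto
    qed
    show "emeasure (D \<mu>) {..\<chi> i. real n} \<noteq> \<infinity>" for n
      using fin[of "\<chi> i. real n"] by (simp add: D sets cap)
  qed
  \<comment> \<open>On the sphere \<open>sgn\<close> undoes the normalisation \<open>?g\<close>, so
    every Borel set \<open>U\<close> in the orthant part of the sphere is recovered from its image
    measure.\<close>
  moreover have "?O \<inter> ?g -` (sgn -` U) = U"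
  proof -
    have h: "sgn (?g x) = x" if "x \<in> ?O" for x
    proof -
      have "x \<noteq> 0" "norm x = 1" using that by auto
      then have "sgn (?g x) = sgn x"
        using l1_norm_pos[of x] by (simp add: sgn_scaleR)
      then show ?thesis using \<open>norm x = 1\<close> by (simp add: sgn_div_norm)
    qed
    have "x \<in> ?O \<inter> ?g -` (sgn -` U) \<longleftrightarrow> x \<in> U" for x
      using h[of x] U(2) by (cases "x \<in> ?O") auto
    then show ?thesis by blast
  qed
  moreover have "sgn -` U \<in> sets borel"
    using measurable_sets[OF borel_measurable_sgn U(1)] by simp
  ultimately show ?thesis
    using D[OF sets(1), of "sgn -` U"] D[OF sets(2), of "sgn -` U"] by simp
qed

text \<open>A Borel set is cut into finitely many pieces of constant sign pattern, and flipping each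
  piece by its own pattern moves it into the nonnegative orthant.\<close>

lemma measure_eqI_flip:
  fixes \<mu> \<nu> :: "(real ^ 'n) measure"
  assumes sets: "sets \<mu> = sets (restrict_space borel (sphere 0 1))"
      "sets \<nu> = sets (restrict_space borel (sphere 0 1))"
    and inv: "\<And>\<sigma> U. (\<forall>i. \<sigma> $ i \<in> {1, - 1}) \<Longrightarrow> U \<in> sets \<mu> \<Longrightarrow>
        emeasure \<mu> (flip \<sigma> ` U) = emeasure \<mu> U"
      "\<And>\<sigma> U. (\<forall>i. \<sigma> $ i \<in> {1, - 1}) \<Longrightarrow> U \<in> sets \<nu> \<Longrightarrow>
        emeasure \<nu> (flip \<sigma> ` U) = emeasure \<nu> U"
    and eq: "\<And>U. U \<in> sets borel \<Longrightarrow> U \<subseteq> sphere 0 1 \<inter> nonneg_orthant \<Longrightarrow> emeasure \<mu> U = emeasure \<nu> U"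
  shows "\<mu> = \<nu>"
proof (rule measure_eqI)
  show "sets \<mu> = sets \<nu>" using sets by simp
  fix U assume "U \<in> sets \<mu>"
  then have U: "U \<in> sets borel" "U \<subseteq> sphere 0 1" using sets sets_sphere_iff by blast+
  \<comment> \<open>Zero coordinates count as positive, so each point has exactly one pattern and
    the pieces are disjoint.\<close>
  define S where "S x = (\<chi> i. if x $ i \<ge> 0 then 1 else (- 1 :: real))" for x :: "real ^ 'n"
  define \<Sigma> where "\<Sigma> = {\<sigma> :: real ^ 'n. \<forall>i. \<sigma> $ i \<in> {1, - 1}}"
  define P where "P \<sigma> = U \<inter> S -` {\<sigma>}" for \<sigma>
  have "\<Sigma> \<subseteq> vec_lambda ` (UNIV \<rightarrow>\<^sub>E {1, - 1})"
  proof
    fix \<sigma> :: "real ^ 'n" assume "\<sigma> \<in> \<Sigma>"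
    then have "vec_nth \<sigma> \<in> UNIV \<rightarrow>\<^sub>E {1, - 1}" by (auto simp: \<Sigma>_def PiE_def)
    then show "\<sigma> \<in> vec_lambda ` (UNIV \<rightarrow>\<^sub>E {1, - 1})" by (metis image_eqI vec_nth_inverse)
  qed
  then have fin: "finite \<Sigma>"
    by (rule finite_subset) (intro finite_imageI finite_PiE, auto)
  have "S -` {\<sigma>} \<in> sets borel" for \<sigma>
  proof -
    have "S -` {\<sigma>} = {x. \<forall>i. (x $ i \<ge> 0 \<and> \<sigma> $ i = 1) \<or> (x $ i < 0 \<and> \<sigma> $ i = - 1)}"
      by (auto simp: S_def vec_eq_iff) (metis linorder_not_le)+
    also have "\<dots> \<in> sets borel" by measurable
    finally show ?thesis .
  qed
  then have P_borel: "P \<sigma> \<in> sets borel" for \<sigma> using U(1) by (auto simp: P_def)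
  have P_sphere: "P \<sigma> \<subseteq> sphere 0 1" for \<sigma> using U(2) by (auto simp: P_def)
  have U_eq: "U = (\<Union>\<sigma>\<in>\<Sigma>. P \<sigma>)"
    by (auto simp: P_def \<Sigma>_def S_def)
  have disj: "disjoint_family_on P \<Sigma>"
    by (auto simp: disjoint_family_on_def P_def)
  have split: "emeasure \<kappa> U = (\<Sum>\<sigma>\<in>\<Sigma>. emeasure \<kappa> (P \<sigma>))"
    if "sets \<kappa> = sets (restrict_space borel (sphere 0 1))" for \<kappa>
    unfolding U_eq using fin disj P_borel P_sphere
    by (intro sum_emeasure[symmetric]) (auto simp: that sets_sphere_iff)
  have "emeasure \<mu> (P \<sigma>) = emeasure \<nu> (P \<sigma>)" if "\<sigma> \<in> \<Sigma>" for \<sigma>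
  proof -
    have \<sigma>: "\<forall>i. \<sigma> $ i \<in> {1, - 1}" using that by (simp add: \<Sigma>_def)
    have "flip \<sigma> ` P \<sigma> \<subseteq> sphere 0 1 \<inter> nonneg_orthant"
      using P_sphere[of \<sigma>] by (auto simp: norm_flip[OF \<sigma>]) (auto simp: P_def S_def flip_def nonneg_orthant_def)
    then have "emeasure \<mu> (flip \<sigma> ` P \<sigma>) = emeasure \<nu> (flip \<sigma> ` P \<sigma>)"
      using flip_borel[OF \<sigma> P_borel] by (rule eq[rotated])
    moreover have "P \<sigma> \<in> sets \<mu>" "P \<sigma> \<in> sets \<nu>"
      unfolding sets sets_sphere_iff using P_borel P_sphere by auto
    ultimately show ?thesis
      using inv \<sigma> by metis
  qed
  then show "emeasure \<mu> U = emeasure \<nu> U"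
    using split[OF sets(1)] split[OF sets(2)] by simp
qed

section \<open>Identification of the harmonic counting measure\<close>

theorem theorem4:
  fixes q :: int and p :: "int ^ 'n" and T :: "(real ^ 'n) set"
    and A :: "real ^ 'n ^ 'n" and U :: "(real ^ 'n) set"
  assumes "CARD('n) \<ge> 2"
    and "q > 0"
    and "\<And>j. coprime (p $ j) q"
    and "T = congruence_lattice q p"
    and "generating_matrix A T"
    and "U \<in> sets borel" and "U \<subseteq> sphere 0 1"
  shows "let v = Beta (real CARD('n) - 1) (real CARD('n) + 1)
                   / (fact (CARD('n) - 2) * 2 ^ (CARD('n) - 1))
                   * measure lebesgue ((\<lambda>x. matrix_inv A *v x) ` (cone_over U \<inter> l1_unit_ball))
         in emeasure (harmonic_counting_measure T) U = ennreal v \<and>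
            (negligible (frontier (cone_over U)) \<longrightarrow>
              (\<lambda>t. real (harmonic_count (T \<inter> cone_over U) t) / real t ^ (2 * CARD('n) - 1))
                \<longlonglongrightarrow> v)"
proof -
  define b where "b = Beta (real CARD('n) - 1) (real CARD('n) + 1) / (fact (CARD('n) - 2) * 2 ^ (CARD('n) - 1))"
  define v where "v V = b * measure lebesgue ((*v) A -` (cone_over V \<inter> l1_unit_ball))" for V
  have b: "b \<ge> 0"
    using assms(1) unfolding b_def Beta_def
    by (intro divide_nonneg_pos mult_nonneg_nonneg less_imp_le[OF Gamma_real_pos] Gamma_real_pos) auto
  have inv: "invertible A"
    using assms generating_matrix_invertible by blast
  have T: "T = range (\<lambda>z. A *v int_vec z)"
    by (rule generating_matrix_range[OF assms(5)])
  have T_int: "T \<subseteq> range int_vec"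
    unfolding assms(4) congruence_lattice_def by auto
  have lim: "(\<lambda>t. real (harmonic_count (T \<inter> cone_over V) t) / real t ^ (2 * CARD('n) - 1)) \<longlonglongrightarrow> v V"
    if "V \<in> sets borel" "V \<subseteq> sphere 0 1" "negligible (frontier (cone_over V))" for V
    using harmonic_count_tendsto[OF assms(1) inv T T_int that] by (simp add: v_def b_def)
  have "linear ((*v) A)" by simp
  moreover have "bij ((*v) A)" using inv invertible_eq_bij by blast
  ultimately obtain c where c: "c \<ge> 0"
    "\<And>S. S \<in> sets borel \<Longrightarrow> emeasure lborel ((*v) A -` S) = ennreal c * emeasure lborel S"
    using emeasure_linear_vimage by metis
  \<comment> \<open>Pulling back along \<open>A\<close> multiplies volumes by \<open>c\<close>, so
    scaling by \<open>b * c\<close> makes the value at \<open>V\<close> equal to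
    \<open>v V\<close>.\<close>
  define \<nu> :: "(real ^ 'n) measure" where "\<nu> = cone_measure (b * c)"
  have sets_\<nu>: "sets \<nu> = sets (restrict_space borel (sphere 0 1))"
    unfolding \<nu>_def by (rule sets_cone_measure)
  have \<nu>: "emeasure \<nu> V = ennreal (v V)" if V: "V \<in> sets borel" "V \<subseteq> sphere 0 1" for V
  proof -
    let ?E = "cone_over V \<inter> l1_unit_ball"
    have E: "?E \<in> sets borel" using cone_over_borel[OF V(2,1)] l1_unit_ball_borel by auto
    have E_fin: "emeasure lborel ?E < \<infinity>"
      by (intro emeasure_bounded_finite bounded_Int disjI2 bounded_l1_unit_ball)
    have lin: "(*v) A \<in> borel_measurable borel"
      by (intro borel_measurable_continuous_onI linear_continuous_on) (simp add: linear_conv_bounded_linear[symmetric])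
    have D: "(*v) A -` ?E \<in> sets borel"
      using measurable_sets[OF lin E] by simp
    have "emeasure \<nu> V = ennreal (b * c) * emeasure lborel ?E"
      unfolding \<nu>_def by (rule emeasure_cone_measure[OF V])
    also have "\<dots> = ennreal b * emeasure lborel ((*v) A -` ?E)"
      by (simp only: c(2)[OF E] ennreal_mult[OF b c(1)] mult.assoc)
    also have "emeasure lborel ((*v) A -` ?E) = ennreal (measure lborel ((*v) A -` ?E))"
      using E_fin c(2)[OF E] by (intro emeasure_eq_ennreal_measure) (auto simp: ennreal_mult_eq_top_iff)
    also have "measure lborel ((*v) A -` ?E) = measure lebesgue ((*v) A -` ?E)"
      using D by simp
    finally show ?thesis
      using b by (simp add: v_def ennreal_mult)
  qed
  have hcm: "is_harmonic_counting_measure T \<nu>"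
    unfolding is_harmonic_counting_measure_def
  proof (intro conjI ballI impI allI)
    show "sets \<nu> = sets (restrict_space borel (sphere 0 1))" by (rule sets_\<nu>)
    fix V assume "V \<in> sets \<nu>"
    then have V: "V \<in> sets borel" "V \<subseteq> sphere 0 1" using sets_\<nu> sets_sphere_iff by blast+
    show "(\<lambda>t. ennreal (real (harmonic_count (T \<inter> cone_over V) t) / real t ^ (2 * CARD('n) - 1)))
        \<longlonglongrightarrow> emeasure \<nu> V"
      if "cone_over V \<subseteq> nonneg_orthant \<and> negligible (frontier (cone_over V))"
      using lim[OF V] that unfolding \<nu>[OF V] by (intro tendsto_ennrealI) auto
    show "emeasure \<nu> ((\<lambda>x. \<chi> i. \<sigma> $ i * x $ i) ` V) = emeasure \<nu> V"
      if "\<forall>i. \<sigma> $ i \<in> {1, - 1}" for \<sigma>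
      using emeasure_cone_measure_flip[OF that V] by (simp add: \<nu>_def flip_def[abs_def])
  qed
  have "harmonic_counting_measure T = \<nu>"
    unfolding harmonic_counting_measure_def
  proof (rule the_equality[where P = "is_harmonic_counting_measure T", OF hcm])
    fix \<mu> :: "(real ^ 'n) measure"
    assume \<mu>: "is_harmonic_counting_measure T \<mu>"
    then have sets_\<mu>: "sets \<mu> = sets (restrict_space borel (sphere 0 1))"
      by (simp add: is_harmonic_counting_measure_def)
    have cap: "orthant_cap a \<in> sets borel" "orthant_cap a \<subseteq> sphere 0 1" for a :: "real ^ 'n"
      by (rule orthant_cap_borel) (auto simp: orthant_cap_def)
    have flip_inv: "emeasure \<kappa> (flip \<sigma> ` V) = emeasure \<kappa> V"
      if "is_harmonic_counting_measure T \<kappa>" "\<forall>i. \<sigma> $ i \<in> {1, - 1}" "V \<in> sets \<kappa>" for \<kappa> \<sigma> V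
      using that by (simp add: is_harmonic_counting_measure_def flip_def[abs_def])
    \<comment> \<open>The caps satisfy the side conditions of the definition, so both values are
      limits of the same sequence.\<close>
    have cap_eq: "emeasure \<nu> (orthant_cap a) = emeasure \<mu> (orthant_cap a)" for a
    proof (rule LIMSEQ_unique)
      have *: "orthant_cap a \<in> sets \<mu>" "orthant_cap a \<in> sets \<nu>"
        unfolding sets_\<mu> sets_\<nu> sets_sphere_iff using cap by auto
      show "(\<lambda>t. ennreal (real (harmonic_count (T \<inter> cone_over (orthant_cap a)) t) / real t ^ (2 * CARD('n) - 1)))
          \<longlonglongrightarrow> emeasure \<mu> (orthant_cap a)"
        using \<mu> * orthant_cap_cone[of a] unfolding is_harmonic_counting_measure_def by blast
      show "(\<lambda>t. ennreal (real (harmonic_count (T \<inter> cone_over (orthant_cap a)) t) / real t ^ (2 * CARD('n) - 1)))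
          \<longlonglongrightarrow> emeasure \<nu> (orthant_cap a)"
        using hcm * orthant_cap_cone[of a] unfolding is_harmonic_counting_measure_def by blast
    qed
    have fin: "emeasure \<nu> (orthant_cap a) < \<infinity>" for a
      using \<nu>[OF cap] by simp
    have "\<nu> = \<mu>"
      using flip_inv[OF hcm] flip_inv[OF \<mu>] measure_eqI_orthant_cap[OF sets_\<nu> sets_\<mu> cap_eq fin]
      by (intro measure_eqI_flip[OF sets_\<nu> sets_\<mu>]) auto
    then show "\<mu> = \<nu>" ..
  qed
  then show ?thesis
    unfolding Let_def matrix_inv_image[OF inv]
    using \<nu>[OF assms(6,7)] lim[OF assms(6,7)] by (simp add: v_def b_def)
qed

end
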